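(* Let $f(z)\in\mathbb{Q}[[z]]$ be a delta series with compositional inverse $g(z)$, and let $C^f_m$ be the operators on $\Lambda$ determined by $\sum_m (-1)^m C^f_m z^m = U_f\circ C(z)\circ U_g$. For each partition $\lambda$, with conjugate $\lambda'=(\lambda'_1,\dots,\lambda'_m)$, set $$P_\lambda(X)=C^f_{\lambda'_1}\circ C^f_{\lambda'_2}\circ\cdots\circ C^f_{\lambda'_m}[1].$$ Then the (in general non-homogeneous) basis $\{P_\lambda(X)\}$ of the ring of symmetric functions $\Lambda$ is of Littlewood--Richardson type, that is, for every partition $\lambda$, $$P_\lambda(X+X')=\sum_{\mu,\nu}c^{\lambda}_{\mu\nu}\,P_\mu(X)\,P_\nu(X').$$
   Context: $\Lambda$ is the ring of symmetric functions over $\mathbb{Q}$ in infinitely many variables $X=\{x_1,x_2,\dots\}$, with complete symmetric functions $h_n(X)$, elementary symmetric functions $e_n(X)$ and Schur functions $s_\lambda(X)$. $F(X+X')$ denotes $F$ evaluated on the disjoint union of the alphabets $X$ and $X'$; for a single variable $u$, $F(X+u)$ denotes $F$ evaluated on the alphabet $X$ with the variable $u$ adjoined. The Littlewood--Richardson numbers $c^\lambda_{\mu\nu}$ are defined by $s_\lambda(X+X')=\sum_{\mu,\nu}c^\lambda_{\mu\nu}s_\mu(X)s_\nu(X')$ (equivalently $s_\mu s_\nu=\sum_\lambda c^\lambda_{\mu\nu}s_\lambda$). A delta series is a formal power series that is invertible with respect to composition (zero constant term, nonzero linear coefficient); its compositional inverse $g$ satisfies $f(g(z))=g(f(z))=z$.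 For a delta series $f$ define $r_n(X)\in\Lambda$ by $\prod_{x\in X}\frac{1}{1-f(z)x}=\sum_{n\ge0}r_n(X)z^n$. The umbral operator $U_f:\Lambda\to\Lambda$ is the $\mathbb{Q}$-algebra homomorphism with $U_f[h_n(X)]=r_n(X)$ for all $n$; $U_g$ is defined in the same way from $g$, and $U_f^{-1}=U_g$. The column operator for Schur functions is $C(z)=\sum_{m\in\mathbb{Z}}(-1)^mC_mz^m=\mathcal{P}(-z)\,\mathcal{T}(1/z)$, where $\mathcal{P}(-z)$ is multiplication by $\prod_{x\in X}(1-xz)$ and $\mathcal{T}(u)[F(X)]=F(X+u)$. Explicitly, $C_m=\sum_{k\ge0}(-1)^k e_{m+k}(X)\,\partial_{h_k}$, where $\partial_{h_k}$ is the adjoint, with respect to the Hall inner product, of multiplication by $h_k$. Consequently $C^f_m=U_f\circ C_m\circ U_g$. *)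

theory Defs
  imports
    "HOL-Library.Multiset"
    "HOL-Library.Countable"
    "HOL-Library.Infinite_Set"
    "HOL-Computational_Algebra.Formal_Power_Series"
    "HOL-Computational_Algebra.Formal_Laurent_Series"
begin

section \<open>Formal power series over the rationals in an arbitrary alphabet\<close>

text \<open>The monomials in the variables \<open>x\<^sub>v\<close>, \<open>v :: 'v\<close>, are the finite multisets of variables.\<close>

typedef 'v mps = "UNIV :: ('v multiset \<Rightarrow> rat) set"
  morphisms mcoeff Mps
  by simp

setup_lifting type_definition_mps

lemma mps_eqI: "(\<And>M. mcoeff F M = mcoeff G M) \<Longrightarrow> F = G"
  by (metis mcoeff_inject ext)

lemma finite_submultisets [simp, intro]: "finite {A. A \<subseteq># M}"
proof (induction M)
  case empty
  then show ?case by simp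
next
  case (add x M)
  have "{A. A \<subseteq># add_mset x M} \<subseteq> {A. A \<subseteq># M} \<union> add_mset x ` {A. A \<subseteq># M}"
  proof
    fix A assume "A \<in> {A. A \<subseteq># add_mset x M}"
    then have A: "A \<subseteq># add_mset x M" by simp
    show "A \<in> {A. A \<subseteq># M} \<union> add_mset x ` {A. A \<subseteq># M}"
    proof (cases "x \<in># A")
      case True
      then obtain B where "A = add_mset x B" by (meson mset_add)
      with A show ?thesis by auto
    next
      case False
      with A have "A \<subseteq># M"
        unfolding subseteq_mset_def by (metis count_add_mset not_in_iff le0)
      then show ?thesis by simp
    qed
  qed
  with add show ?case by (meson finite_Un finite_imageI finite_subset)
qed

instantiation mps :: (type) comm_ring_1
begin

definition zero_mps :: "'a mps" where "0 = Mps (\<lambda>M. 0)"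
definition one_mps :: "'a mps" where "1 = Mps (\<lambda>M. if M = {#} then 1 else 0)"
definition plus_mps :: "'a mps \<Rightarrow> 'a mps \<Rightarrow> 'a mps"
  where "F + G = Mps (\<lambda>M. mcoeff F M + mcoeff G M)"
definition uminus_mps :: "'a mps \<Rightarrow> 'a mps" where "- F = Mps (\<lambda>M. - mcoeff F M)"
definition minus_mps :: "'a mps \<Rightarrow> 'a mps \<Rightarrow> 'a mps"
  where "F - G = Mps (\<lambda>M. mcoeff F M - mcoeff G M)"
definition times_mps :: "'a mps \<Rightarrow> 'a mps \<Rightarrow> 'a mps"
  where "F * G = Mps (\<lambda>M. \<Sum>A\<in>{A. A \<subseteq># M}. mcoeff F A * mcoeff G (M - A))"

lemma mcoeff_simps:
  "mcoeff 0 M = 0"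
  "mcoeff 1 M = (if M = {#} then 1 else 0)"
  "mcoeff (F + G) M = mcoeff F M + mcoeff G M"
  "mcoeff (- F) M = - mcoeff F M"
  "mcoeff (F - G) M = mcoeff F M - mcoeff G M"
  by (simp_all add: zero_mps_def one_mps_def plus_mps_def uminus_mps_def minus_mps_def
      Mps_inverse)

lemma mcoeff_times:
  "mcoeff (F * G) M = (\<Sum>A\<in>{A. A \<subseteq># M}. mcoeff F A * mcoeff G (M - A))"
  by (simp add: times_mps_def Mps_inverse)

instance
proof
  fix F G H :: "'a mps"
  show "F * G * H = F * (G * H)"
  proof (rule mps_eqI)
    fix M :: "'a multiset"
    have "mcoeff (F * G * H) M =
        (\<Sum>(C,A)\<in>(SIGMA C:{C. C \<subseteq># M}. {A. A \<subseteq># C}). mcoeff F A * mcoeff G (C - A) * mcoeff H (M - C))"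
      by (simp add: mcoeff_times sum_distrib_right sum.Sigma)
    also have "\<dots> =
        (\<Sum>(A,B)\<in>(SIGMA A:{A. A \<subseteq># M}. {B. B \<subseteq># M - A}). mcoeff F A * (mcoeff G B * mcoeff H (M - A - B)))"
    proof (rule sum.reindex_bij_witness[where j = "\<lambda>(C,A). (A, C - A)" and i = "\<lambda>(A,B). (A + B, A)"],
        goal_cases)
      case (1 a)
      then show ?case by auto
    next
      case (2 a)
      then show ?case by (auto simp: subseteq_mset_def diff_le_mono intro: order_trans)
    next
      case (3 b)
      then show ?case by auto
    next
      case (4 b)
      then show ?case by (auto simp: subseteq_mset_def) (metis add.commute le_diff_conv2)
    next
      case (5 a)
      then show ?case by (auto simp: mult.assoc)
    qed
    also have "\<dots> = mcoeff (F * (G * H)) M"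
      by (simp add: mcoeff_times sum_distrib_left sum.Sigma)
    finally show "mcoeff (F * G * H) M = mcoeff (F * (G * H)) M" .
  qed
  show "F * G = G * F"
  proof (rule mps_eqI)
    fix M :: "'a multiset"
    have double_diff: "M - (M - A) = A" if "A \<subseteq># M" for A
      using that by (simp add: multiset_eq_iff subseteq_mset_def)
    show "mcoeff (F * G) M = mcoeff (G * F) M"
      unfolding mcoeff_times
      by (rule sum.reindex_bij_witness[where j = "\<lambda>A. M - A" and i = "\<lambda>A. M - A"])
        (auto simp: double_diff mult.commute)
  qed
  show "1 * F = F"
  proof (rule mps_eqI)
    fix M :: "'a multiset"
    have "mcoeff (1 * F) M = (\<Sum>A\<in>{A. A \<subseteq># M}. if A = {#} then mcoeff F M else 0)"
      unfolding mcoeff_times by (rule sum.cong) (auto simp: mcoeff_simps)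
    then show "mcoeff (1 * F) M = mcoeff F M" by (simp add: sum.delta)
  qed
  show "(F + G) * H = F * H + G * H"
    by (rule mps_eqI) (simp add: mcoeff_times mcoeff_simps ring_distribs sum.distrib)
  show "F + G + H = F + (G + H)" "F + G = G + F" "0 + F = F" "- F + F = 0" "F - G = F + - G"
    by (rule mps_eqI, simp add: mcoeff_simps)+
  show "(0::'a mps) \<noteq> 1"
    by (metis mcoeff_simps(1,2) zero_neq_one)
qed

end

definition scale_mps :: "rat \<Rightarrow> 'v mps \<Rightarrow> 'v mps"
  where "scale_mps c F = Mps (\<lambda>M. c * mcoeff F M)"

text \<open>The ring homomorphism \<open>x\<^sub>v \<mapsto> x\<^bsub>i v\<^esub>\<close> induced by an injection \<open>i\<close> of alphabets.\<close>

definition embed_mps :: "('v \<Rightarrow> 'w) \<Rightarrow> 'v mps \<Rightarrow> 'w mps"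
  where "embed_mps i F =
    Mps (\<lambda>M. if set_mset M \<subseteq> range i then mcoeff F (image_mset (inv i) M) else 0)"


section \<open>The ring of symmetric functions\<close>

definition symmetric_mps :: "nat mps \<Rightarrow> bool"
  where "symmetric_mps F \<longleftrightarrow> (\<forall>p M. bij p \<longrightarrow> mcoeff F (image_mset p M) = mcoeff F M)"

definition bounded_degree :: "'v mps \<Rightarrow> bool"
  where "bounded_degree F \<longleftrightarrow> (\<exists>d. \<forall>M. mcoeff F M \<noteq> 0 \<longrightarrow> size M \<le> d)"

typedef sym = "{F :: nat mps. symmetric_mps F \<and> bounded_degree F}"
  morphisms mps_of_sym Abs_sym
  by (rule exI[of _ 0]) (simp add: symmetric_mps_def bounded_degree_def mcoeff_simps)

setup_lifting type_definition_sym

lemma symmetric_mps_times: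
  assumes "symmetric_mps F" "symmetric_mps G"
  shows "symmetric_mps (F * G)"
  unfolding symmetric_mps_def
proof (intro allI impI)
  fix p :: "nat \<Rightarrow> nat" and M assume p: "bij p"
  have inv: "inv p \<circ> p = id" "p \<circ> inv p = id"
    using p by (auto simp: bij_def surj_iff)
  have inj: "inj p" using p by (simp add: bij_def)
  have [simp]: "image_mset (inv p) (image_mset p A) = A" "image_mset p (image_mset (inv p) A) = A" for A
    using inv by (simp_all add: multiset.map_comp)
  show "mcoeff (F * G) (image_mset p M) = mcoeff (F * G) M"
    unfolding mcoeff_times
  proof (rule sum.reindex_bij_witness[where i = "image_mset p" and j = "image_mset (inv p)"])
    fix A assume "A \<in> {A. A \<subseteq># image_mset p M}"
    then have A: "A \<subseteq># image_mset p M" by simp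
    show "image_mset p (image_mset (inv p) A) = A" by simp
    from image_mset_subseteq_mono[OF A, of "inv p"]
    show B: "image_mset (inv p) A \<in> {A. A \<subseteq># M}" by simp
    have "image_mset p M - A = image_mset p (M - image_mset (inv p) A)"
      using B by (simp add: image_mset_Diff)
    then show "mcoeff F (image_mset (inv p) A) * mcoeff G (M - image_mset (inv p) A) =
        mcoeff F A * mcoeff G (image_mset p M - A)"
      using assms p unfolding symmetric_mps_def
      by (metis (no_types) \<open>image_mset p (image_mset (inv p) A) = A\<close>)
  qed (auto intro: image_mset_subseteq_mono)
qed

lemma bounded_degree_times:
  assumes "bounded_degree F" "bounded_degree G"
  shows "bounded_degree (F * G)"
proof -
  obtain d e where d: "\<And>M. mcoeff F M \<noteq> 0 \<Longrightarrow> size M \<le> d"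
    and e: "\<And>M. mcoeff G M \<noteq> 0 \<Longrightarrow> size M \<le> e"
    using assms by (auto simp: bounded_degree_def)
  have "size M \<le> d + e" if M: "mcoeff (F * G) M \<noteq> 0" for M
  proof -
    obtain A where A: "A \<subseteq># M" "mcoeff F A * mcoeff G (M - A) \<noteq> 0"
      using M unfolding mcoeff_times by (blast elim: sum.not_neutral_contains_not_neutral)
    then have "size A \<le> d" "size (M - A) \<le> e" using d e by auto
    moreover have "size M = size A + size (M - A)"
      using A(1) by (metis size_union subset_mset.add_diff_inverse)
    ultimately show ?thesis by linarith
  qed
  then show ?thesis unfolding bounded_degree_def by blast
qed

lemma bounded_degree_plus:
  assumes "bounded_degree F" "bounded_degree G"
  shows "bounded_degree (F + G)" "bounded_degree (F - G)"
proof -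
  obtain d e where d: "\<And>M. mcoeff F M \<noteq> 0 \<Longrightarrow> size M \<le> d"
    and e: "\<And>M. mcoeff G M \<noteq> 0 \<Longrightarrow> size M \<le> e"
    using assms by (auto simp: bounded_degree_def)
  have "mcoeff F M \<noteq> 0 \<or> mcoeff G M \<noteq> 0 \<Longrightarrow> size M \<le> max d e" for M
    using d[of M] e[of M] by auto
  then show "bounded_degree (F + G)" "bounded_degree (F - G)"
    unfolding bounded_degree_def mcoeff_simps
    by (intro exI[of _ "max d e"] allI impI; force)+
qed

instantiation sym :: comm_ring_1
begin

lift_definition zero_sym :: sym is 0
  by (simp add: symmetric_mps_def bounded_degree_def mcoeff_simps)
lift_definition one_sym :: sym is 1
  by (auto simp: symmetric_mps_def bounded_degree_def mcoeff_simps)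
lift_definition plus_sym :: "sym \<Rightarrow> sym \<Rightarrow> sym" is "(+)"
  using bounded_degree_plus by (auto simp: symmetric_mps_def mcoeff_simps)
lift_definition uminus_sym :: "sym \<Rightarrow> sym" is uminus
  by (auto simp: symmetric_mps_def bounded_degree_def mcoeff_simps)
lift_definition minus_sym :: "sym \<Rightarrow> sym \<Rightarrow> sym" is "(-)"
  using bounded_degree_plus by (auto simp: symmetric_mps_def mcoeff_simps)
lift_definition times_sym :: "sym \<Rightarrow> sym \<Rightarrow> sym" is "(*)"
  using symmetric_mps_times bounded_degree_times by blast

instance
  by standard (transfer, simp add: algebra_simps)+

end

lift_definition scale_sym :: "rat \<Rightarrow> sym \<Rightarrow> sym" is scale_mps
  by (auto simp: symmetric_mps_def bounded_degree_def scale_mps_def Mps_inverse)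

global_interpretation sym: vector_space scale_sym
  by standard (transfer, rule mps_eqI,
      simp add: scale_mps_def Mps_inverse mcoeff_simps algebra_simps)+

lift_definition sym_h :: "nat \<Rightarrow> sym" is "\<lambda>n. Mps (\<lambda>M. if size M = n then 1 else 0)"
  by (auto simp: symmetric_mps_def bounded_degree_def Mps_inverse)

lift_definition sym_e :: "nat \<Rightarrow> sym" is
  "\<lambda>n. Mps (\<lambda>M. if size M = n \<and> (\<forall>x. count M x \<le> 1) then 1 else 0)"
proof -
  fix n
  have *: "(\<forall>x. count (image_mset p M) x \<le> 1) \<longleftrightarrow> (\<forall>x. count M x \<le> 1)"
    if "bij p" for p :: "nat \<Rightarrow> nat" and M
  proof -
    have p: "inj p" "surj p" using that by (auto simp: bij_def)
    have "count (image_mset p M) (p x) = count M x" for x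
      using p(1) by (induction M) (auto dest: injD)
    with p(2) show ?thesis by (metis surjD)
  qed
  show "symmetric_mps (Mps (\<lambda>M. if size M = n \<and> (\<forall>x. count M x \<le> 1) then 1 else 0)) \<and>
    bounded_degree (Mps (\<lambda>M::nat multiset. if size M = n \<and> (\<forall>x. count M x \<le> 1) then 1 else 0))"
    using * by (auto simp: symmetric_mps_def bounded_degree_def Mps_inverse)
qed

text \<open>
  \<open>on_alphabet F\<close> is \<open>F\<close> evaluated on the alphabet \<open>{x\<^sub>v | v :: 'v}\<close>; since \<open>F\<close> is symmetric,
  the choice of the injective enumeration \<^const>\<open>to_nat\<close> is irrelevant
  (lemma \<open>mcoeff_sym_inj\<close> below).  The disjoint union \<open>X + X'\<close> is the alphabet
  \<^typ>\<open>nat + nat\<close>, and \<open>X + u\<close> is \<^typ>\<open>nat option\<close> with \<open>u\<close> indexed by \<^const>\<open>None\<close>.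
\<close>

definition on_alphabet :: "sym \<Rightarrow> 'v :: countable mps"
  where "on_alphabet F = Mps (\<lambda>M. mcoeff (mps_of_sym F) (image_mset to_nat M))"

lemma mcoeff_sym_inj:
  fixes i j :: "'v \<Rightarrow> nat"
  assumes "inj i" "inj j"
  shows "mcoeff (mps_of_sym F) (image_mset i M) = mcoeff (mps_of_sym F) (image_mset j M)"
proof -
  define A B where "A = i ` set_mset M" and "B = j ` set_mset M"
  have fin: "finite A" "finite B" by (simp_all add: A_def B_def)
  define q where "q = (\<lambda>x. j (inv i x))"
  have q: "bij_betw q A B"
  proof (rule bij_betw_imageI)
    show "inj_on q A"
      using assms by (auto simp: A_def q_def inj_on_def)
    show "q ` A = B"
      using assms(1) by (auto simp: A_def B_def q_def image_image)
  qed
  have "infinite (- A)" "infinite (- B)"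
    using fin by (simp_all add: finite_compl)
  then have "bij_betw (enumerate (- B) \<circ> inv_into UNIV (enumerate (- A))) (- A) (- B)"
    by (intro bij_betw_trans[OF bij_betw_inv_into[OF bij_enumerate] bij_enumerate])
  then obtain r where r: "bij_betw r (- A) (- B)" by blast
  define p where "p = (\<lambda>x. if x \<in> A then q x else r x)"
  have "bij_betw p (A \<union> - A) (B \<union> - B)"
  proof (rule bij_betw_combine)
    show "bij_betw p A B" using q by (rule bij_betw_cong[THEN iffD1, rotated]) (simp add: p_def)
    show "bij_betw p (- A) (- B)"
      using r by (rule bij_betw_cong[THEN iffD1, rotated]) (simp add: p_def)
  qed simp
  then have p: "bij p" by simp
  have "image_mset p (image_mset i M) = image_mset j M"
    unfolding multiset.map_comp
    by (rule image_mset_cong) (use assms(1) in \<open>simp add: p_def q_def A_def\<close>)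
  moreover have "symmetric_mps (mps_of_sym F)" using mps_of_sym by auto
  ultimately show ?thesis using p unfolding symmetric_mps_def by metis
qed

lemma on_alphabet_nat: "on_alphabet F = mps_of_sym F"
  by (rule mps_eqI) (use mcoeff_sym_inj[of to_nat id F] in \<open>simp add: on_alphabet_def Mps_inverse\<close>)


section \<open>Partitions, Schur functions and Littlewood--Richardson numbers\<close>

definition partitions :: "nat list set"
  where "partitions = {l. sorted_wrt (\<ge>) l \<and> 0 \<notin> set l}"

definition conj_partition :: "nat list \<Rightarrow> nat list"
  where "conj_partition l =
    (if l = [] then [] else map (\<lambda>j. length (filter (\<lambda>a. j < a) l)) [0..<hd l])"

text \<open>Semistandard tableaux in English notation, as lists of rows, with entries in \<open>\<nat>\<close>.\<close>

definition ssyt :: "nat list \<Rightarrow> nat list list set"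
  where "ssyt l = {T. map length T = l \<and> (\<forall>row \<in> set T. sorted row) \<and>
    (\<forall>i j. Suc i < length T \<longrightarrow> j < length (T ! Suc i) \<longrightarrow> T ! i ! j < T ! Suc i ! j)}"

text \<open>The generating function of tableaux is symmetric (Bender--Knuth) and homogeneous of
  degree \<open>sum_list l\<close>, so \<^const>\<open>Abs_sym\<close> is applied here to an element of its domain.\<close>

definition schur :: "nat list \<Rightarrow> sym"
  where "schur l = Abs_sym (Mps (\<lambda>M. of_nat (card {T \<in> ssyt l. mset (concat T) = M})))"

text \<open>\<open>F(X+X')\<close>, and \<open>\<Sum>\<^bsub>\<mu>,\<nu>\<^esub> c \<mu> \<nu> B\<^sub>\<mu>(X) B\<^sub>\<nu>(X')\<close> for finitely supported \<open>c\<close>.\<close>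

definition on_two_alphabets :: "sym \<Rightarrow> (nat + nat) mps"
  where "on_two_alphabets F = on_alphabet F"

definition two_alphabet_sum ::
    "(nat list \<Rightarrow> nat list \<Rightarrow> rat) \<Rightarrow> (nat list \<Rightarrow> sym) \<Rightarrow> (nat + nat) mps"
  where "two_alphabet_sum c B =
    (\<Sum>(\<mu>, \<nu>) \<in> {(\<mu>, \<nu>). c \<mu> \<nu> \<noteq> 0}.
       scale_mps (c \<mu> \<nu>) (embed_mps Inl (mps_of_sym (B \<mu>)) * embed_mps Inr (mps_of_sym (B \<nu>))))"

definition lr_coeff :: "nat list \<Rightarrow> nat list \<Rightarrow> nat list \<Rightarrow> rat"
  where "lr_coeff l = (THE c. finite {(\<mu>, \<nu>). c \<mu> \<nu> \<noteq> 0} \<and>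
    {(\<mu>, \<nu>). c \<mu> \<nu> \<noteq> 0} \<subseteq> partitions \<times> partitions \<and>
    on_two_alphabets (schur l) = two_alphabet_sum c schur)"

definition basis_of_sym :: "(nat list \<Rightarrow> sym) \<Rightarrow> bool"
  where "basis_of_sym B \<longleftrightarrow> inj_on B partitions \<and>
    sym.independent (B ` partitions) \<and> sym.span (B ` partitions) = UNIV"

definition lr_type :: "(nat list \<Rightarrow> sym) \<Rightarrow> bool"
  where "lr_type B \<longleftrightarrow>
    (\<forall>l \<in> partitions. on_two_alphabets (B l) = two_alphabet_sum (lr_coeff l) B)"


section \<open>Umbral operators\<close>

definition delta_series :: "rat fps \<Rightarrow> bool"
  where "delta_series f \<longleftrightarrow> fps_nth f 0 = 0 \<and> fps_nth f 1 \<noteq> 0"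

text \<open>
  \<open>r\<^sub>n\<close> is the coefficient of \<open>z\<^sup>n\<close> in \<open>\<Prod>\<^sub>x 1 / (1 - f(z) x)\<close>: expanding each factor as
  \<open>\<Sum>\<^sub>k f(z)\<^sup>k x\<^sup>k\<close>, the coefficient of a monomial in the product is the product of
  \<open>f(z)\<^sup>k\<close> over the variables of the monomial, \<open>k\<close> being the exponent of the variable.
\<close>

definition umbral_r :: "rat fps \<Rightarrow> nat \<Rightarrow> nat mps"
  where "umbral_r f n = Mps (\<lambda>M. fps_nth (\<Prod>x \<in> set_mset M. f ^ count M x) n)"

lemma umbral_r_sym:
  assumes "delta_series f"
  shows "symmetric_mps (umbral_r f n) \<and> bounded_degree (umbral_r f n)"
proof -
  have prod: "(\<Prod>x \<in> set_mset M. f ^ count M x) = f ^ size M" for M :: "nat multiset"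
    by (simp add: size_multiset_overloaded_eq power_sum)
  have zero: "fps_nth (f ^ k) n = 0" if "n < k" for k
    using assms that by (simp add: delta_series_def startsby_zero_power_prefix)
  then have "size M \<le> n" if "mcoeff (umbral_r f n) M \<noteq> 0" for M
    using that zero[of "size M"] by (intro leI) (auto simp: umbral_r_def prod Mps_inverse)
  then show ?thesis
    unfolding symmetric_mps_def bounded_degree_def
    by (auto simp: umbral_r_def prod Mps_inverse)
qed

definition sym_algebra_hom :: "(sym \<Rightarrow> sym) \<Rightarrow> bool"
  where "sym_algebra_hom U \<longleftrightarrow> U 1 = 1 \<and>
    (\<forall>F G. U (F + G) = U F + U G) \<and> (\<forall>F G. U (F * G) = U F * U G) \<and>
    (\<forall>c F. U (scale_sym c F) = scale_sym c (U F))"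

definition umbral :: "rat fps \<Rightarrow> sym \<Rightarrow> sym"
  where "umbral f = (THE U. sym_algebra_hom U \<and> (\<forall>n. mps_of_sym (U (sym_h n)) = umbral_r f n))"


section \<open>Column operators\<close>

text \<open>
  \<open>adjoin_coeff F k\<close> is the coefficient of \<open>u\<^sup>k\<close> in \<open>F(X+u)\<close>, i.e.
  \<open>\<T>(u) F = F(X+u) = \<Sum>\<^sub>k adjoin_coeff F k u\<^sup>k\<close>, a polynomial in \<open>u\<close> over \<^typ>\<open>sym\<close>.
\<close>

definition adjoin_mps :: "sym \<Rightarrow> nat \<Rightarrow> nat mps"
  where "adjoin_mps F k = Mps (\<lambda>M.
    mcoeff (on_alphabet F :: nat option mps) (image_mset Some M + replicate_mset k None))"

lemma adjoin_mps_sym: "symmetric_mps (adjoin_mps F k) \<and> bounded_degree (adjoin_mps F k)"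
proof
  show "symmetric_mps (adjoin_mps F k)"
    unfolding symmetric_mps_def
  proof (intro allI impI)
    fix p :: "nat \<Rightarrow> nat" and M assume "bij p"
    then have "inj (map_option p)" by (simp add: bij_def option.inj_map)
    then have "inj (to_nat \<circ> map_option p)" by (simp add: inj_compose)
    from mcoeff_sym_inj[OF this inj_to_nat, of F "image_mset Some M + replicate_mset k None"]
    show "mcoeff (adjoin_mps F k) (image_mset p M) = mcoeff (adjoin_mps F k) M"
      by (simp add: adjoin_mps_def on_alphabet_def Mps_inverse multiset.map_comp comp_def)
  qed
  have "bounded_degree (mps_of_sym F)" using mps_of_sym by auto
  then obtain d where d: "\<And>M. mcoeff (mps_of_sym F) M \<noteq> 0 \<Longrightarrow> size M \<le> d"
    by (auto simp: bounded_degree_def)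
  have "size M \<le> d" if "mcoeff (adjoin_mps F k) M \<noteq> 0" for M
    using d that unfolding adjoin_mps_def on_alphabet_def by (fastforce simp: Mps_inverse)
  then show "bounded_degree (adjoin_mps F k)" unfolding bounded_degree_def by blast
qed

definition adjoin_coeff :: "sym \<Rightarrow> nat \<Rightarrow> sym"
  where "adjoin_coeff F k = Abs_sym (adjoin_mps F k)"

lemma mps_of_adjoin_coeff: "mps_of_sym (adjoin_coeff F k) = adjoin_mps F k"
  using adjoin_mps_sym by (simp add: adjoin_coeff_def Abs_sym_inverse)

lemma adjoin_coeff_eventually_0: "\<exists>d. \<forall>k>d. adjoin_coeff F k = 0"
proof -
  have "bounded_degree (mps_of_sym F)" using mps_of_sym by auto
  then obtain d where d: "\<And>M. mcoeff (mps_of_sym F) M \<noteq> 0 \<Longrightarrow> size M \<le> d"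
    by (auto simp: bounded_degree_def)
  have "adjoin_coeff F k = 0" if "k > d" for k
  proof -
    have "mcoeff (adjoin_mps F k) M = 0" for M
      using d[of "image_mset to_nat (image_mset Some M + replicate_mset k None)"] that
      by (auto simp: adjoin_mps_def on_alphabet_def Mps_inverse)
    then have "mps_of_sym (adjoin_coeff F k) = mps_of_sym 0"
      by (intro mps_eqI) (simp add: mps_of_adjoin_coeff zero_sym.rep_eq mcoeff_simps)
    then show ?thesis by (simp add: mps_of_sym_inject)
  qed
  then show ?thesis by blast
qed

text \<open>The formal series \<open>\<T>(1/z) F\<close> and
  \<open>C(z) F = \<P>(-z) \<T>(1/z) F\<close> in \<open>\<Lambda>((z))\<close>, where
  \<open>\<P>(-z) = \<Prod>\<^sub>x (1 - x z) = \<Sum>\<^sub>n (-1)\<^sup>n e\<^sub>n z\<^sup>n\<close>.\<close>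

definition adjoin_inverse :: "sym \<Rightarrow> sym fls"
  where "adjoin_inverse F = Abs_fls (\<lambda>m. if m \<le> 0 then adjoin_coeff F (nat (- m)) else 0)"

lemma adjoin_inverse_nth:
  "fls_nth (adjoin_inverse F) m = (if m \<le> 0 then adjoin_coeff F (nat (- m)) else 0)"
proof -
  obtain d where d: "\<forall>k>d. adjoin_coeff F k = 0" using adjoin_coeff_eventually_0 by blast
  show ?thesis
    unfolding adjoin_inverse_def
    by (rule nth_Abs_fls_lower_bound[of "- int d"]) (use d in auto)
qed

definition column_series :: "sym \<Rightarrow> sym fls"
  where "column_series F = fps_to_fls (Abs_fps (\<lambda>n. (- 1) ^ n * sym_e n)) * adjoin_inverse F"

definition column_op :: "int \<Rightarrow> sym \<Rightarrow> sym"
  where "column_op m F =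
    (if even m then fls_nth (column_series F) m else - fls_nth (column_series F) m)"

text \<open>As \<open>U\<^sub>f\<close> acts coefficientwise on \<open>\<Lambda>((z))\<close>,
  \<open>\<Sum>\<^sub>m (-1)\<^sup>m C\<^sup>f\<^sub>m z\<^sup>m = U\<^sub>f \<circ> C(z) \<circ> U\<^sub>g\<close> amounts to the following.\<close>

definition umbral_column_op :: "rat fps \<Rightarrow> rat fps \<Rightarrow> int \<Rightarrow> sym \<Rightarrow> sym"
  where "umbral_column_op f g m = umbral f \<circ> column_op m \<circ> umbral g"

definition umbral_schur :: "rat fps \<Rightarrow> rat fps \<Rightarrow> nat list \<Rightarrow> sym"
  where "umbral_schur f g l =
    foldr (\<lambda>m. umbral_column_op f g (int m)) (conj_partition l) 1"

end

theory Submission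
  imports Defs
begin

text \<open>
  The column operators build the Schur functions column by column, and conjugating them by the
  algebra automorphism \<open>U\<^sub>f\<close>, whose inverse is \<open>U\<^sub>g\<close>, turns \<open>s\<^sub>\<lambda>\<close> into
  \<open>P\<^sub>\<lambda> = U\<^sub>f[s\<^sub>\<lambda>]\<close> (\<open>umbral_schur_eq\<close>).  As \<open>U\<^sub>f\<close> is bijective, the \<open>P\<^sub>\<lambda>\<close> form a basis because
  the \<open>s\<^sub>\<lambda>\<close> do.  Moreover \<open>U\<^sub>f\<close> commutes with the coproduct \<open>F(X) \<mapsto> F(X+X')\<close>
  (\<open>parallel_on_two_alphabets\<close>): all maps involved are algebra homomorphisms, and on the generators
  \<open>h\<^sub>n\<close> the claim is that \<open>\<Prod>\<^sub>x 1/(1 - f(z) x)\<close> is multiplicative in the alphabet.  Applying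
  \<open>U\<^sub>f \<otimes> U\<^sub>f\<close> to the expansion of \<open>s\<^sub>\<lambda>(X+X')\<close> therefore gives that of \<open>P\<^sub>\<lambda>(X+X')\<close>, with the
  same coefficients.

  The facts about symmetric functions used here are all derived from the operators
  \<open>\<partial>\<^bsub>h\<^sub>k\<^esub>\<close>, which extract the coefficient of \<open>u\<^sup>k\<close> in \<open>F(X+u)\<close>.  A family of operators \<open>A\<^sub>m\<close> with
  \<open>\<partial>\<^bsub>h\<^sub>k\<^esub> A\<^sub>m = A\<^sub>m \<partial>\<^bsub>h\<^sub>k\<^esub> + A\<^bsub>m-1\<^esub> \<partial>'\<close> for \<open>k, m \<ge> 1\<close>, where \<open>\<partial>'\<close> is adjoint
  to multiplication by \<open>h\<^bsub>k-1\<^esub>\<close>, yields the functions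
  \<open>A\<^bsub>a\<^sub>1\<^esub> \<dots> A\<^bsub>a\<^sub>l\<^esub> 1\<close>, indexed by
  partitions \<open>a\<close>, on which \<open>\<partial>\<^bsub>h\<^sub>l\<^esub>\<close> subtracts \<open>1\<close> from each \<open>a\<^sub>i\<close> and \<open>\<partial>\<^bsub>h\<^sub>k\<^esub>\<close> vanishes for \<open>k > l\<close>;
  by this triangularity they are a basis.  Taking for \<open>A\<^sub>m\<close> multiplication by \<open>e\<^sub>m\<close> shows that
  \<open>\<Lambda>\<close> is a polynomial ring in the \<open>e\<^sub>n\<close>, hence, by \<open>\<Sum>\<^sub>i (-1)\<^sup>i e\<^sub>i h\<^bsub>n-i\<^esub> = 0\<close>, that algebra homomorphisms are
  uniquely determined by arbitrary values at the \<open>h\<^sub>n\<close>, \<open>n \<ge> 1\<close>.  Taking for \<open>A\<^sub>m\<close> the column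
  operator \<open>C\<^sub>m\<close> gives the Schur basis: since \<open>C\<^sub>m C\<^bsub>m+1\<^esub> = 0\<close>, the
  operator \<open>\<partial>\<^bsub>h\<^sub>k\<^esub>\<close> sends the function of a partition \<open>\<lambda>\<close> to the sum over all \<open>\<mu>\<close> with \<open>\<lambda>/\<mu>\<close> a
  horizontal strip of size \<open>k\<close>
  (\<open>hperp_col_strips\<close>), and removing the largest entries of semistandard tableaux obeys the same
  recursion (\<open>bij_betw_tableaux\<close>), so the coefficients count tableaux (\<open>card_tableaux\<close>).
\<close>

section \<open>Coefficients of symmetric functions\<close>

abbreviation sym_coeff :: "sym \<Rightarrow> nat multiset \<Rightarrow> rat"
  where "sym_coeff F M \<equiv> mcoeff (mps_of_sym F) M"

lemma sym_eqI: "(\<And>M. sym_coeff F M = sym_coeff G M) \<Longrightarrow> F = G"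
  by (metis mps_of_sym_inject mps_eqI)

lemma mcoeff_scale: "mcoeff (scale_mps c F) M = c * mcoeff F M"
  by (simp add: scale_mps_def Mps_inverse)

lemma mcoeff_sum: "mcoeff (sum F A) M = (\<Sum>x\<in>A. mcoeff (F x) M)"
  by (induction A rule: infinite_finite_induct) (simp_all add: mcoeff_simps)

lemma sym_coeff_simps:
  "sym_coeff 0 M = 0"
  "sym_coeff 1 M = (if M = {#} then 1 else 0)"
  "sym_coeff (F + G) M = sym_coeff F M + sym_coeff G M"
  "sym_coeff (- F) M = - sym_coeff F M"
  "sym_coeff (F - G) M = sym_coeff F M - sym_coeff G M"
  "sym_coeff (scale_sym c F) M = c * sym_coeff F M"
  by (simp_all add: zero_sym.rep_eq one_sym.rep_eq plus_sym.rep_eq uminus_sym.rep_eq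
      minus_sym.rep_eq scale_sym.rep_eq mcoeff_simps mcoeff_scale)

lemma sym_coeff_sum: "sym_coeff (sum F A) M = (\<Sum>x\<in>A. sym_coeff (F x) M)"
  by (induction A rule: infinite_finite_induct) (simp_all add: sym_coeff_simps)

lemma sym_coeff_times:
  "sym_coeff (F * G) M = (\<Sum>A\<in>{A. A \<subseteq># M}. sym_coeff F A * sym_coeff G (M - A))"
  by (simp add: times_sym.rep_eq mcoeff_times)

lemma sym_coeff_h: "sym_coeff (sym_h n) M = (if size M = n then 1 else 0)"
  by (simp add: sym_h.rep_eq Mps_inverse)

lemma sym_coeff_e:
  "sym_coeff (sym_e n) M = (if size M = n \<and> (\<forall>x. count M x \<le> 1) then 1 else 0)"
  by (simp add: sym_e.rep_eq Mps_inverse)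

lemma sym_h_0 [simp]: "sym_h 0 = 1" and sym_e_0 [simp]: "sym_e 0 = 1"
  by (rule sym_eqI; auto simp: sym_coeff_h sym_coeff_e sym_coeff_simps)+

lemma scale_sym_mult: "scale_sym c F * G = scale_sym c (F * G)" "F * scale_sym c G = scale_sym c (F * G)"
proof -
  show "scale_sym c F * G = scale_sym c (F * G)" for F G
    by (rule sym_eqI) (simp add: sym_coeff_times sym_coeff_simps sum_distrib_left mult.assoc)
  then show "F * scale_sym c G = scale_sym c (F * G)"
    by (simp add: mult.commute)
qed

lemma bounded_sym: obtains d where "\<And>M. sym_coeff F M \<noteq> 0 \<Longrightarrow> size M \<le> d"
proof -
  have "bounded_degree (mps_of_sym F)" using mps_of_sym by auto
  then show ?thesis using that by (auto simp: bounded_degree_def)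
qed

lemma fresh_variable: obtains a :: nat where "a \<notin># M"
  using ex_new_if_finite[of "set_mset M"] by auto

lemma sym_eqI_fresh: "(\<And>M a. a \<notin># M \<Longrightarrow> sym_coeff F M = sym_coeff G M) \<Longrightarrow> F = G"
  by (rule sym_eqI) (metis fresh_variable)

text \<open>The divisors of the monomial \<open>M a\<^sup>k\<close> are the products of a divisor of \<open>M\<close> and a power of \<open>a\<close>.\<close>

lemma sum_submultisets_replicate:
  assumes a: "a \<notin># M"
  shows "(\<Sum>A\<in>{A. A \<subseteq># M + replicate_mset k a}. F A) =
    (\<Sum>i\<le>k. \<Sum>A\<in>{A. A \<subseteq># M}. F (A + replicate_mset i a) :: 'b :: comm_monoid_add)"
proof -
  have cM: "count M a = 0" using a by (simp add: not_in_iff)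
  have "(\<Sum>i\<le>k. \<Sum>A\<in>{A. A \<subseteq># M}. F (A + replicate_mset i a)) =
    (\<Sum>(i, A)\<in>{..k} \<times> {A. A \<subseteq># M}. F (A + replicate_mset i a))"
    by (simp add: sum.cartesian_product)
  also have "\<dots> = (\<Sum>A\<in>{A. A \<subseteq># M + replicate_mset k a}. F A)"
  proof (rule sum.reindex_bij_witness[where i = "\<lambda>A. (count A a, filter_mset (\<lambda>x. x \<noteq> a) A)"
        and j = "\<lambda>(i, A). A + replicate_mset i a"], goal_cases)
    case (1 p)
    then obtain i A where p: "p = (i, A)" "A \<subseteq># M" by auto
    then have "count A a = 0" using cM by (metis le_zero_eq mset_subset_eq_count)
    then show ?case by (auto simp: p multiset_eq_iff)
  next
    case (2 p)
    then show ?case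
      using cM by (auto simp: subseteq_mset_def intro: add_mono trans_le_add1) (metis add_0 le_zero_eq)
  next
    case (3 A)
    then show ?case by (auto simp: multiset_eq_iff)
  next
    case (4 A)
    then show ?case using cM
      by (auto simp: subseteq_mset_def) (metis add_0 , metis add.right_neutral)
  qed auto
  finally show ?thesis by simp
qed


section \<open>The operators adjoint to multiplication by complete symmetric functions\<close>

text \<open>\<open>hperp k F\<close> is the coefficient of \<open>u\<^sup>k\<close> in \<open>F(X+u)\<close>, that is, \<open>\<partial>\<^bsub>h\<^sub>k\<^esub> F\<close>.\<close>

abbreviation hperp :: "nat \<Rightarrow> sym \<Rightarrow> sym"
  where "hperp k F \<equiv> adjoin_coeff F k"

text \<open>By symmetry, any variable \<open>a\<close> outside the monomial may play the role of \<open>u\<close>.\<close>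

lemma sym_coeff_hperp:
  assumes "a \<notin># M"
  shows "sym_coeff (hperp k F) M = sym_coeff F (M + replicate_mset k a)"
proof -
  obtain b where b: "\<And>x. x \<in># M \<Longrightarrow> x < b" "a < b"
    using finite_nat_set_iff_bounded[of "insert a (set_mset M)"] by auto
  \<comment> \<open>An injection of \<open>X + u\<close> into \<open>X\<close> that sends \<open>u\<close> to \<open>a\<close> and fixes the variables of \<open>M\<close>; the others are moved out of the way.\<close>
  define j where "j = (\<lambda>x. case x of None \<Rightarrow> a | Some y \<Rightarrow> if y \<in># M then y else y + b)"
  have "inj j"
    using b assms by (force simp: inj_on_def j_def split: option.splits if_splits)
  then have "sym_coeff F (image_mset to_nat (image_mset Some M + replicate_mset k None)) =
    sym_coeff F (image_mset j (image_mset Some M + replicate_mset k None))"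
    by (intro mcoeff_sym_inj) auto
  moreover have "image_mset j (image_mset Some M) = M"
    by (simp add: multiset.map_comp j_def comp_def cong: image_mset_cong)
  ultimately show ?thesis
    by (simp add: mps_of_adjoin_coeff adjoin_mps_def on_alphabet_def Mps_inverse j_def)
qed

lemma hperp_add: "hperp k (F + G) = hperp k F + hperp k G"
  and hperp_diff: "hperp k (F - G) = hperp k F - hperp k G"
  and hperp_scale: "hperp k (scale_sym c F) = scale_sym c (hperp k F)"
  and hperp_zero [simp]: "hperp k 0 = 0"
  by (rule sym_eqI_fresh, simp add: sym_coeff_hperp sym_coeff_simps)+

lemma hperp_sum: "hperp k (sum F A) = (\<Sum>x\<in>A. hperp k (F x))"
  by (induction A rule: infinite_finite_induct) (simp_all add: hperp_add)

lemma hperp_uminus: "hperp k (- F) = - hperp k F"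
  using hperp_diff[of 0 F k] by simp

lemma hperp_0 [simp]: "hperp 0 F = F"
  by (rule sym_eqI_fresh) (simp add: sym_coeff_hperp)

lemma hperp_1: "hperp k 1 = (if k = 0 then 1 else 0)"
  by (rule sym_eqI_fresh)
    (simp add: sym_coeff_hperp sym_coeff_simps)

lemma hperp_commute: "hperp j (hperp k F) = hperp k (hperp j F)"
proof (rule sym_eqI)
  fix M :: "nat multiset"
  obtain a where a: "a \<notin># M" by (rule fresh_variable[of M])
  obtain b where b: "b \<notin># M + {#a#}" by (rule fresh_variable[of "M + {#a#}"])
  have 1: "b \<notin># M + replicate_mset i a" "a \<notin># M + replicate_mset i b" "b \<notin># M" for i
    using a b by auto
  show "sym_coeff (hperp j (hperp k F)) M = sym_coeff (hperp k (hperp j F)) M"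
    using sym_coeff_hperp[OF a, of "hperp k F" j] sym_coeff_hperp[OF 1(1), of F k j]
      sym_coeff_hperp[OF 1(3), of "hperp j F" k] sym_coeff_hperp[OF 1(2), of F j k]
    by (simp add: ac_simps)
qed

lemma hperp_times: "hperp k (F * G) = (\<Sum>i\<le>k. hperp i F * hperp (k - i) G)"
proof (rule sym_eqI)
  fix M :: "nat multiset"
  obtain a where a: "a \<notin># M" by (rule fresh_variable[of M])
  have sub: "a \<notin># A" "a \<notin># M - A" if "A \<subseteq># M" for A
    using a that by (auto dest: mset_subset_eqD in_diffD)
  have eq: "M + replicate_mset k a - (A + replicate_mset i a) = M - A + replicate_mset (k - i) a"
    if "A \<subseteq># M" "i \<le> k" for A i
    using that by (auto simp: multiset_eq_iff subseteq_mset_def)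
  have inner: "(\<Sum>A | A \<subseteq># M. sym_coeff F (A + replicate_mset i a) *
        sym_coeff G (M + replicate_mset k a - (A + replicate_mset i a))) =
      (\<Sum>A | A \<subseteq># M. sym_coeff (hperp i F) A * sym_coeff (hperp (k - i) G) (M - A))"
    if "i \<le> k" for i
    by (intro sum.cong refl)
      (simp add: eq[OF _ that] sym_coeff_hperp[OF sub(1)] sym_coeff_hperp[OF sub(2)])
  show "sym_coeff (hperp k (F * G)) M = sym_coeff (\<Sum>i\<le>k. hperp i F * hperp (k - i) G) M"
    unfolding sym_coeff_hperp[OF a] sym_coeff_times sum_submultisets_replicate[OF a] sym_coeff_sum
    by (rule sum.cong[OF refl]) (simp only: inner atMost_iff)
qed

lemma hperp_h: "hperp k (sym_h n) = (if k \<le> n then sym_h (n - k) else 0)"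
  by (rule sym_eqI_fresh) (auto simp: sym_coeff_hperp sym_coeff_h sym_coeff_simps)

lemma hperp_e:
  "hperp k (sym_e n) = (if k = 0 then sym_e n else if k = 1 \<and> n > 0 then sym_e (n - 1) else 0)"
proof (rule sym_eqI)
  fix M :: "nat multiset"
  obtain a where a: "a \<notin># M" by (rule fresh_variable[of M])
  have "(\<forall>x. count (M + replicate_mset k a) x \<le> 1) \<longleftrightarrow> (\<forall>x. count M x \<le> 1) \<and> k \<le> 1"
    using a by (force simp: not_in_iff)
  then show "sym_coeff (hperp k (sym_e n)) M =
    sym_coeff (if k = 0 then sym_e n else if k = 1 \<and> n > 0 then sym_e (n - 1) else 0) M"
    by (auto simp: sym_coeff_hperp[OF a] sym_coeff_e sym_coeff_simps)
qed

lemma hperp_e_times: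
  "hperp (Suc k) (sym_e (Suc n) * F) = sym_e (Suc n) * hperp (Suc k) F + sym_e n * hperp k F"
proof -
  have "(\<Sum>i\<le>Suc k. hperp i (sym_e (Suc n)) * hperp (Suc k - i) F) =
    (\<Sum>i\<in>{0, 1}. hperp i (sym_e (Suc n)) * hperp (Suc k - i) F)"
    by (rule sum.mono_neutral_right) (auto simp: hperp_e)
  then show ?thesis by (simp add: hperp_times hperp_e)
qed

lemma hperp_eventually_zero: obtains d where "\<forall>k>d. hperp k F = 0"
  using adjoin_coeff_eventually_0 by blast

lemma eq_const_if_hperp_zero:
  assumes "\<And>k. k > 0 \<Longrightarrow> hperp k F = 0"
  shows "F = scale_sym (sym_coeff F {#}) 1"
proof (rule sym_eqI)
  fix M :: "nat multiset"
  show "sym_coeff F M = sym_coeff (scale_sym (sym_coeff F {#}) 1) M"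
  proof (cases "M = {#}")
    case False
    then obtain a where a: "a \<in># M" by auto
    define N where "N = filter_mset (\<lambda>x. x \<noteq> a) M"
    have M: "M = N + replicate_mset (count M a) a"
      by (auto simp: N_def multiset_eq_iff)
    have "sym_coeff F M = sym_coeff (hperp (count M a) F) N"
      by (subst M, subst sym_coeff_hperp[of a]) (auto simp: N_def)
    with False assms a show ?thesis by (simp add: sym_coeff_simps)
  qed (simp add: sym_coeff_simps)
qed

lemma hperp_nilpotent:
  assumes "k > 0"
  obtains n where "(hperp k ^^ n) F = 0"
proof -
  obtain d where d: "\<And>M. sym_coeff F M \<noteq> 0 \<Longrightarrow> size M \<le> d" by (rule bounded_sym) blast
  have "sym_coeff ((hperp k ^^ n) F) M \<noteq> 0 \<Longrightarrow> size M + n \<le> d" for n M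
  proof (induction n arbitrary: M)
    case 0
    then show ?case using d by simp
  next
    case (Suc n)
    obtain a where a: "a \<notin># M" by (rule fresh_variable[of M])
    have "size (M + replicate_mset k a) + n \<le> d"
      using Suc by (intro Suc.IH) (simp add: sym_coeff_hperp[OF a])
    with assms show ?case by simp
  qed
  from this[of "Suc d"] have "(hperp k ^^ Suc d) F = 0"
    by (intro sym_eqI) (auto simp: sym_coeff_simps)
  then show ?thesis by (rule that)
qed


section \<open>Column operators\<close>

lemma column_op_eq:
  assumes d: "\<forall>k>d. hperp k F = 0"
  shows "column_op (int m) F = (\<Sum>k\<le>d. (- 1) ^ k * (sym_e (m + k) * hperp k F))"
proof -
  define E where "E = Abs_fps (\<lambda>n. (- 1) ^ n * sym_e n)"
  \<comment> \<open>\<open>P\<close> is the polynomial \<open>z\<^sup>d F(X + 1/z)\<close>.\<close>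
  define P where "P = Abs_fps (\<lambda>i. if i \<le> d then hperp (d - i) F else 0)"
  have "adjoin_inverse F = fls_shift (int d) (fps_to_fls P)"
  proof (rule fls_eqI)
    fix i :: int
    have "d - nat (i + int d) = nat (- i)" if "i \<le> 0" "i + int d \<ge> 0"
      using that by linarith
    then show "fls_nth (adjoin_inverse F) i = fls_nth (fls_shift (int d) (fps_to_fls P)) i"
      using d by (auto simp: adjoin_inverse_nth P_def)
  qed
  then have "column_series F = fls_shift (int d) (fps_to_fls (E * P))"
    by (simp add: column_series_def E_def fls_shifted_times_simps fls_times_fps_to_fls)
  then have "fls_nth (column_series F) (int m) = (E * P) $ (m + d)"
    by (simp add: nat_add_distrib)
  also have "\<dots> = (\<Sum>i=0..m + d. (- 1) ^ i * sym_e i * P $ (m + d - i))"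
    by (simp add: fps_mult_nth E_def)
  also have "\<dots> = (\<Sum>i\<in>{m..m + d}. (- 1) ^ i * sym_e i * P $ (m + d - i))"
    by (rule sum.mono_neutral_right) (auto simp: P_def)
  also have "\<dots> = (\<Sum>k\<le>d. (- 1) ^ (m + k) * sym_e (m + k) * hperp k F)"
    by (rule sum.reindex_bij_witness[of _ "\<lambda>k. m + k" "\<lambda>i. i - m"]) (auto simp: P_def)
  finally have coeff: "fls_nth (column_series F) (int m) =
    (- 1) ^ m * (\<Sum>k\<le>d. (- 1) ^ k * (sym_e (m + k) * hperp k F))"
    by (simp add: sum_distrib_left power_add mult.assoc)
  show ?thesis
    by (cases "even m") (simp_all add: column_op_def coeff)
qed

lemma column_op_0_1: "column_op 0 1 = 1"
  using column_op_eq[of 0 1 0] by (simp add: hperp_1)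

lemma column_op_zero: "column_op (int m) 0 = 0"
  using column_op_eq[of 0 0 m] by simp

lemma sym_coeff_column_op_empty:
  assumes "m > 0"
  shows "sym_coeff (column_op (int m) F) {#} = 0"
proof -
  obtain d where d: "\<forall>k>d. hperp k F = 0" using hperp_eventually_zero by blast
  have [simp]: "{A. A = {#}} = {{#} :: nat multiset}" by auto
  show ?thesis
    using assms
    by (simp add: column_op_eq[OF d] sym_coeff_sum mult.left_commute[of "(- 1) ^ _"]
        sym_coeff_times sym_coeff_e)
qed

lemma hperp_minus_one_power_mult: "hperp k ((- 1) ^ j * F) = (- 1) ^ j * hperp k F"
  by (cases "even j") (simp_all add: hperp_uminus)

text \<open>The relation \<open>\<T>(u) C(z) = (1 - u z) C(z) \<T>(u)\<close>, in coefficients, for columns of positive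
  length and positive powers of \<open>u\<close>.\<close>

lemma hperp_column_op:
  "hperp (Suc k) (column_op (int (Suc m)) F) =
    column_op (int (Suc m)) (hperp (Suc k) F) + column_op (int m) (hperp k F)"
proof -
  obtain d where d: "\<forall>k>d. hperp k F = 0" using hperp_eventually_zero by blast 
  have d': "\<forall>j>d. hperp j (hperp i F) = 0" for i
    using d by (simp add: hperp_commute[where k = i])
  show ?thesis
    unfolding column_op_eq[OF d] column_op_eq[OF d'] hperp_sum sum.distrib[symmetric]
    by (rule sum.cong) (simp_all add: hperp_minus_one_power_mult hperp_e_times ring_distribs
        hperp_commute[where F = F and k = k] hperp_commute[where F = F and k = "Suc k"])
qed

text \<open>Written out by the product rule, the left-hand side is a double sum that changes sign when
  its two summation indices are swapped.\<close>

lemma column_op_Suc_eq_0: "column_op (int m) (column_op (int (Suc m)) F) = 0"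
proof -
  obtain d where d: "\<forall>k>d. hperp k F = 0" using hperp_eventually_zero by blast
  have d': "\<forall>j>d. hperp j (hperp i F) = 0" for i
    using d by (simp add: hperp_commute[where k = i])
  define G where "G = column_op (int (Suc m)) F"
  define T where "T = (\<lambda>j k. (- 1) ^ (j + k) * ((sym_e (m + j) * sym_e (Suc m + k)
    - sym_e (Suc m + j) * sym_e (m + k)) * hperp j (hperp k F)))"
  have hG: "hperp (Suc j) G = column_op (int (Suc m)) (hperp (Suc j) F) + column_op (int m) (hperp j F)" for j
    by (simp only: G_def hperp_column_op)
  have dG: "\<forall>j>Suc d. hperp j G = 0"
  proof (intro allI impI)
    fix j assume "j > Suc d"
    then obtain i where "j = Suc i" "i > d" by (cases j) auto
    then show "hperp j G = 0"
      using d by (simp only: hG column_op_zero) simp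
  qed
  define W where "W = (\<lambda>n j. column_op (int n) (hperp j F))"
  have "column_op (int m) G = (\<Sum>j\<le>Suc d. (- 1) ^ j * (sym_e (m + j) * hperp j G))"
    by (rule column_op_eq[OF dG])
  also have "\<dots> = (\<Sum>j\<le>Suc d. (- 1) ^ j * (sym_e (m + j) * W (Suc m) j)) +
    (\<Sum>j\<le>d. (- 1) ^ Suc j * (sym_e (Suc m + j) * W m j))"
    unfolding sum.atMost_Suc_shift[of _ d]
    by (simp add: hG W_def G_def[symmetric] ring_distribs sum.distrib sum_negf sum_subtractf
        del: of_nat_Suc)
  also have "(\<Sum>j\<le>Suc d. (- 1) ^ j * (sym_e (m + j) * W (Suc m) j)) =
    (\<Sum>j\<le>d. (- 1) ^ j * (sym_e (m + j) * W (Suc m) j))"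
    using d by (simp add: W_def column_op_zero del: of_nat_Suc)
  also have "\<dots> + (\<Sum>j\<le>d. (- 1) ^ Suc j * (sym_e (Suc m + j) * W m j)) = (\<Sum>j\<le>d. \<Sum>k\<le>d. T j k)"
    unfolding sum.distrib[symmetric] W_def column_op_eq[OF d'] sum_distrib_left
    by (intro sum.cong refl)
       (simp add: T_def power_add hperp_commute algebra_simps)
  finally have GT: "column_op (int m) G = (\<Sum>j\<le>d. \<Sum>k\<le>d. T j k)" .
  have T: "T j k = - T k j" for j k
    by (simp add: T_def hperp_commute[where F = F and j = j and k = k] algebra_simps)
  define S where "S = (\<Sum>j\<le>d. \<Sum>k\<le>d. T j k)"
  have "S = (\<Sum>j\<le>d. \<Sum>k\<le>d. - T k j)"
    unfolding S_def by (intro sum.cong refl T)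
  also have "\<dots> = (\<Sum>k\<le>d. \<Sum>j\<le>d. - T k j)"
    by (rule sum.swap)
  also have "\<dots> = - S"
    by (simp only: S_def sum_negf)
  finally have neg: "S = - S" .
  have "sym_coeff S M = 0" for M
    using arg_cong[OF neg, of "\<lambda>F. sym_coeff F M"] unfolding sym_coeff_simps by linarith
  then have "S = 0"
    by (intro sym_eqI) (simp add: sym_coeff_simps)
  then show ?thesis using GT by (simp only: G_def S_def)
qed


section \<open>Bases indexed by columns\<close>

text \<open>Removing the first row of the diagram with column lengths \<open>a\<close>, and adding a row of
  length \<open>k\<close> on top of it; the latter is meaningful if \<open>a\<close> has at most \<open>k\<close> columns.\<close>

definition remove_row :: "nat list \<Rightarrow> nat list"
  where "remove_row a = filter (\<lambda>x. x \<noteq> 0) (map (\<lambda>x. x - 1) a)"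

definition add_row :: "nat \<Rightarrow> nat list \<Rightarrow> nat list"
  where "add_row k a = map Suc a @ replicate (k - length a) 1"

lemma sorted_wrt_ge_eq_filter_append:
  "sorted_wrt (\<ge>) (a :: nat list) \<Longrightarrow>
    a = filter (\<lambda>x. x \<noteq> 0) a @ replicate (length (filter (\<lambda>x. x = 0) a)) 0"
proof (induction a)
  case (Cons x a)
  show ?case
  proof (cases "x = 0")
    case True
    with Cons.prems have "filter (\<lambda>x. x \<noteq> 0) a = []" by (auto simp: filter_empty_conv)
    with Cons True show ?thesis by simp
  qed (use Cons in simp)
qed simp

lemma sorted_map_pred:
  assumes "a \<in> partitions"
  shows "sorted_wrt (\<ge>) (map (\<lambda>x. x - 1) a)"
  using assms unfolding sorted_wrt_map partitions_def
  by (auto elim!: sorted_wrt_mono_rel[rotated] intro: diff_le_mono)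

lemma remove_row_partition:
  assumes "a \<in> partitions"
  shows "remove_row a \<in> partitions"
  using sorted_map_pred[OF assms]
  by (auto simp: partitions_def remove_row_def intro: sorted_wrt_filter)

lemma add_row_partition: "a \<in> partitions \<Longrightarrow> add_row k a \<in> partitions"
  by (auto simp: partitions_def add_row_def sorted_wrt_append sorted_wrt_map)
    (simp add: sorted_wrt_iff_nth_less)

lemma length_add_row: "length a \<le> k \<Longrightarrow> length (add_row k a) = k"
  by (simp add: add_row_def)

lemma remove_row_add_row: "a \<in> partitions \<Longrightarrow> remove_row (add_row k a) = a"
  by (auto simp: partitions_def remove_row_def add_row_def comp_def filter_id_conv
      intro: gr0I)

lemma length_remove_row: "length (remove_row a) \<le> length a"
  unfolding remove_row_def by (metis length_filter_le length_map)

lemma add_row_remove_row: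
  assumes "a \<in> partitions"
  shows "add_row (length a) (remove_row a) = a"
proof -
  let ?b = "map (\<lambda>x. x - 1) a"
  have b: "?b = remove_row a @ replicate (length (filter (\<lambda>x. x = 0) ?b)) 0"
    (is "_ = _ @ replicate ?n 0")
    using sorted_wrt_ge_eq_filter_append[OF sorted_map_pred[OF assms]] by (simp add: remove_row_def)
  have "length ?b = length (remove_row a) + ?n"
    using arg_cong[OF b, of length] by simp
  then have "add_row (length a) (remove_row a) = map Suc ?b"
    by (subst b) (simp add: add_row_def)
  also have "\<dots> = a"
    using assms unfolding map_map
    by (intro map_idI) (auto simp: partitions_def intro!: Suc_pred gr0I)
  finally show ?thesis .
qed

lemma sum_list_remove_row:
  assumes "a \<in> partitions" "a \<noteq> []"
  shows "sum_list (remove_row a) < sum_list a"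
proof -
  have "sum_list (add_row k b) = sum_list b + length b + (k - length b)" for k b
    by (induction b) (simp_all add: add_row_def sum_list_Suc sum_list_replicate)
  from this[of "length a" "remove_row a"] show ?thesis
    using assms add_row_remove_row[of a] length_remove_row[of a] by (simp add: le_add_diff_inverse)
qed

text \<open>
  Operators \<open>A\<^sub>m\<close> with this commutation rule yield symmetric functions \<open>A\<^bsub>a\<^sub>1\<^esub> \<dots> A\<^bsub>a\<^sub>l\<^esub> 1\<close>, where
  \<open>a\<close> is read as a list of column lengths.  For a partition \<open>a\<close> with \<open>l\<close> columns, \<open>hperp l\<close> removes
  the first row, and \<open>hperp k\<close> with \<open>k > l\<close> gives zero.  This triangularity makes them a basis.
\<close>

locale column_family =
  fixes A :: "nat \<Rightarrow> sym \<Rightarrow> sym"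
  assumes A_0_1: "A 0 1 = 1"
    and A_zero: "A m 0 = 0"
    and hperp_A: "hperp (Suc k) (A (Suc m) F) = A (Suc m) (hperp (Suc k) F) + A m (hperp k F)"
begin

definition col :: "nat list \<Rightarrow> sym"
  where "col a = foldr A a 1"

lemma col_simps [simp]: "col [] = 1" "col (m # a) = A m (col a)"
  by (simp_all add: col_def)

lemma col_append_zeros: "col (a @ replicate n 0) = col a"
proof -
  have "col (replicate n 0) = 1" by (induction n) (simp_all add: A_0_1)
  then show ?thesis by (simp add: col_def)
qed

lemma col_filter: "sorted_wrt (\<ge>) a \<Longrightarrow> col (filter (\<lambda>x. x \<noteq> 0) a) = col a"
  by (metis sorted_wrt_ge_eq_filter_append col_append_zeros)

lemma hperp_col_greater: "0 \<notin> set a \<Longrightarrow> length a < k \<Longrightarrow> hperp k (col a) = 0"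
proof (induction a arbitrary: k)
  case Nil
  then show ?case by (simp add: hperp_1)
next
  case (Cons m a)
  then obtain k' m' where "k = Suc k'" "m = Suc m'"
    by (metis Suc_less_eq2 length_Cons list.set_intros(1) not0_implies_Suc)
  with Cons show ?case by (simp add: hperp_A A_zero)
qed

lemma hperp_col_length: "0 \<notin> set a \<Longrightarrow> hperp (length a) (col a) = col (map (\<lambda>x. x - 1) a)"
proof (induction a)
  case (Cons m a)
  then obtain m' where "m = Suc m'" by (metis list.set_intros(1) not0_implies_Suc)
  with Cons show ?case by (simp add: hperp_A A_zero hperp_col_greater)
qed simp

lemma hperp_col:
  assumes "a \<in> partitions"
  shows "hperp (length a) (col a) = col (remove_row a)"
  unfolding remove_row_def using assms sorted_map_pred[OF assms]
  by (subst col_filter) (auto simp: hperp_col_length partitions_def)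

text \<open>Let \<open>k\<close> be the largest number of columns in a relation.  Applying \<open>hperp k\<close> leaves the terms
  with exactly \<open>k\<close> columns and removes their first rows, which gives a smaller relation.\<close>

lemma col_combination_nonzero:
  assumes "finite T" "T \<subseteq> partitions" "\<forall>a\<in>T. c a \<noteq> 0"
    and "(\<Sum>a\<in>T. scale_sym (c a) (col a)) = 0"
  shows "T = {}"
  using assms
proof (induction "\<Sum>a\<in>T. sum_list a" arbitrary: T c rule: less_induct)
  case less
  show ?case
  proof (rule ccontr)
    assume "T \<noteq> {}"
    define k where "k = Max (length ` T)"
    define T1 where "T1 = {a \<in> T. length a = k}"
    have le: "length a \<le> k" if "a \<in> T" for a
      using less.prems(1) that by (simp add: k_def)
    have "k \<in> length ` T"
      unfolding k_def using less.prems(1) \<open>T \<noteq> {}\<close> by (intro Max_in) auto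
    then have "T1 \<noteq> {}" by (auto simp: T1_def)
    show False
    proof (cases "k = 0")
      case True
      then have "T = {[]}" using le \<open>T \<noteq> {}\<close> by force
      with less.prems(4) have "sym_coeff (scale_sym (c []) 1) {#} = 0"
        by (simp add: sym_coeff_simps)
      with \<open>T = {[]}\<close> less.prems(3) show False by (simp add: sym_coeff_simps)
    next
      case False
      have T1: "finite T1" "T1 \<subseteq> T" "T1 \<subseteq> partitions" "\<And>a. a \<in> T1 \<Longrightarrow> length a = k"
        using less.prems by (auto simp: T1_def)
      have add: "add_row k (remove_row a) = a" if "a \<in> T1" for a
        using add_row_remove_row[of a] that T1 by auto
      have inj: "inj_on remove_row T1"
        by (metis add inj_onI)
      have "(\<Sum>a\<in>T. scale_sym (c a) (hperp k (col a))) = 0"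
        using arg_cong[OF less.prems(4), of "hperp k"] by (simp add: hperp_sum hperp_scale)
      also have "(\<Sum>a\<in>T. scale_sym (c a) (hperp k (col a))) =
        (\<Sum>a\<in>T1. scale_sym (c a) (hperp k (col a)))"
      proof (rule sum.mono_neutral_right)
        show "\<forall>a\<in>T - T1. scale_sym (c a) (hperp k (col a)) = 0"
          using le less.prems(2) hperp_col_greater
          by (fastforce simp: T1_def partitions_def sym.scale_eq_0_iff)
      qed (use less.prems T1 in auto)
      also have "\<dots> = (\<Sum>a\<in>T1. scale_sym (c (add_row k (remove_row a))) (col (remove_row a)))"
        by (rule sum.cong) (use T1 hperp_col add in \<open>auto simp flip: T1(4)\<close>)
      also have "\<dots> = (\<Sum>b\<in>remove_row ` T1. scale_sym (c (add_row k b)) (col b))"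
        by (simp add: sum.reindex[OF inj])
      finally have 0: "(\<Sum>b\<in>remove_row ` T1. scale_sym (c (add_row k b)) (col b)) = 0" .
      have "(\<Sum>b\<in>remove_row ` T1. sum_list b) = (\<Sum>a\<in>T1. sum_list (remove_row a))"
        by (simp add: sum.reindex[OF inj])
      also have "\<dots> < (\<Sum>a\<in>T1. sum_list a)"
        using T1 \<open>T1 \<noteq> {}\<close> False by (intro sum_strict_mono sum_list_remove_row) auto
      also have "\<dots> \<le> (\<Sum>a\<in>T. sum_list a)"
        using less.prems(1) T1 by (intro sum_mono2) auto
      finally have "remove_row ` T1 = {}"
        using T1 less.prems(3) 0 add remove_row_partition
        by (intro less.hyps[of "remove_row ` T1" "\<lambda>b. c (add_row k b)"]) auto
      with \<open>T1 \<noteq> {}\<close> show False by simp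
    qed
  qed
qed

lemma col_combination_eq_0:
  assumes "finite T" "T \<subseteq> partitions" "(\<Sum>a\<in>T. scale_sym (c a) (col a)) = 0" "a \<in> T"
  shows "c a = 0"
proof -
  have "(\<Sum>a\<in>{a\<in>T. c a \<noteq> 0}. scale_sym (c a) (col a)) = (\<Sum>a\<in>T. scale_sym (c a) (col a))"
    using assms(1) by (intro sum.mono_neutral_left) auto
  then have "{a\<in>T. c a \<noteq> 0} = {}"
    using assms by (intro col_combination_nonzero[of _ c]) auto
  with assms(4) show ?thesis by blast
qed

text \<open>On the span of the functions with at most \<open>k\<close> columns, \<open>hperp k\<close> is surjective, since rows of
  length \<open>k\<close> can be added on top, and \<open>hperp j\<close> vanishes for \<open>j > k\<close>.\<close>

lemma span_col_lift:
  assumes "G \<in> sym.span (col ` {a \<in> partitions. length a \<le> k})"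
  shows "(\<exists>H \<in> sym.span (col ` {a \<in> partitions. length a \<le> k}). hperp k H = G) \<and>
    (\<forall>j>k. hperp j G = 0)"
  using assms
proof (induction rule: sym.span_induct_alt)
  case base
  show ?case by (metis hperp_zero sym.span_zero)
next
  case (step c x y)
  then obtain a H where a: "x = col a" "a \<in> partitions" "length a \<le> k"
    and H: "H \<in> sym.span (col ` {a \<in> partitions. length a \<le> k})" "hperp k H = y"
    by auto
  have "col (add_row k a) \<in> col ` {a \<in> partitions. length a \<le> k}"
    using a by (auto simp: add_row_partition length_add_row)
  moreover have "hperp k (col (add_row k a)) = x"
    using hperp_col[OF add_row_partition[OF a(2), of k]] a
    by (simp add: length_add_row remove_row_add_row)
  moreover have "\<forall>j>k. hperp j x = 0"
    using a hperp_col_greater by (auto simp: partitions_def)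
  ultimately show ?case
    using H step by (auto simp: hperp_add hperp_scale
        intro!: bexI[of _ "scale_sym c (col (add_row k a)) + H"] sym.span_add sym.span_scale
        intro: sym.span_base)
qed

text \<open>Induction on \<open>k\<close>, and on the nilpotency order of \<open>F\<close> under \<open>hperp k\<close>: if \<open>hperp k F\<close> is in the
  span, it equals \<open>hperp k H\<close> for some \<open>H\<close> in the span, and \<open>F - H\<close> is annihilated by \<open>hperp k\<close>.\<close>

lemma in_span_col_if_hperp_zero:
  "\<forall>j>k. hperp j F = 0 \<Longrightarrow> F \<in> sym.span (col ` {a \<in> partitions. length a \<le> k})"
proof (induction k arbitrary: F)
  case 0
  then have "F = scale_sym (sym_coeff F {#}) (col [])"
    using eq_const_if_hperp_zero by simp
  moreover have "[] \<in> partitions" by (simp add: partitions_def)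
  ultimately show ?case
    by (metis (mono_tags, lifting) imageI list.size(3) mem_Collect_eq order_refl
        sym.span_base sym.span_scale)
next
  case (Suc k)
  let ?S = "sym.span (col ` {a \<in> partitions. length a \<le> Suc k})"
  obtain n where "(hperp (Suc k) ^^ n) F = 0"
    using hperp_nilpotent[of "Suc k" F] by auto
  then show ?case
    using Suc.prems
  proof (induction n arbitrary: F)
    case 0
    then show ?case by (simp add: sym.span_zero)
  next
    case (Suc n)
    have "hperp (Suc k) F \<in> ?S"
    proof (rule Suc.IH)
      show "(hperp (Suc k) ^^ n) (hperp (Suc k) F) = 0"
        using Suc.prems(1) by (metis comp_apply funpow_Suc_right)
      show "\<forall>j>Suc k. hperp j (hperp (Suc k) F) = 0"
        using Suc.prems(2) by (simp add: hperp_commute[where k = "Suc k"])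
    qed
    then obtain H where H: "H \<in> ?S" "hperp (Suc k) H = hperp (Suc k) F"
      using span_col_lift by blast
    have "hperp j (F - H) = 0" if "j > k" for j
      using that H span_col_lift[OF H(1)] Suc.prems(2)
      by (cases "j = Suc k") (auto simp: hperp_diff)
    then have "F - H \<in> sym.span (col ` {a \<in> partitions. length a \<le> k})"
      by (intro \<open>\<And>F. \<forall>j>k. hperp j F = 0 \<Longrightarrow> F \<in> _\<close>) simp
    also have "\<dots> \<subseteq> ?S" by (intro sym.span_mono) auto
    finally have "F - H + H \<in> ?S" using H(1) by (rule sym.span_add)
    then show ?case by simp
  qed
qed

lemma span_col: "sym.span (col ` partitions) = UNIV"
proof -
  have "F \<in> sym.span (col ` partitions)" for F
  proof -
    obtain k where "\<forall>j>k. hperp j F = 0" by (rule hperp_eventually_zero)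
    then have "F \<in> sym.span (col ` {a \<in> partitions. length a \<le> k})"
      by (rule in_span_col_if_hperp_zero)
    also have "\<dots> \<subseteq> sym.span (col ` partitions)" by (intro sym.span_mono) auto
    finally show ?thesis .
  qed
  then show ?thesis by blast
qed

end

text \<open>The absence of nontrivial relations between indexed vectors also covers injectivity.\<close>

lemma basis_of_symI:
  assumes 0: "\<And>T c a. finite T \<Longrightarrow> T \<subseteq> partitions \<Longrightarrow>
      (\<Sum>a\<in>T. scale_sym (c a) (B a)) = 0 \<Longrightarrow> a \<in> T \<Longrightarrow> c a = 0"
    and span: "sym.span (B ` partitions) = UNIV"
  shows "basis_of_sym B"
proof -
  have inj: "inj_on B partitions"
  proof (rule inj_onI, rule ccontr)
    fix a b assume ab: "a \<in> partitions" "b \<in> partitions" "B a = B b" "a \<noteq> b"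
    have "(\<Sum>x\<in>{a, b}. scale_sym (if x = a then 1 else - 1) (B x)) = 0"
      using ab by simp
    from 0[OF _ _ this, of a] ab show False by simp
  qed
  have indep: "sym.independent (B ` partitions)"
  proof
    assume "sym.dependent (B ` partitions)"
    then obtain S u v where S: "finite S" "S \<subseteq> B ` partitions"
      "(\<Sum>v\<in>S. scale_sym (u v) v) = 0" "v \<in> S" "u v \<noteq> 0"
      by (auto simp: sym.dependent_explicit)
    then obtain T where T: "T \<subseteq> partitions" "S = B ` T" "inj_on B T"
      using inj by (metis inj_on_subset subset_image_iff)
    then have "finite T" "(\<Sum>a\<in>T. scale_sym (u (B a)) (B a)) = 0"
      using S by (auto simp: sum.reindex dest: finite_imageD)
    from 0[OF this(1) T(1) this(2)] S T(2) show False by auto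
  qed
  show ?thesis
    using inj indep span by (simp add: basis_of_sym_def)
qed


section \<open>Algebra homomorphisms on symmetric functions\<close>

interpretation column: column_family "\<lambda>m. column_op (int m)"
  by standard (simp_all only: of_nat_0 column_op_0_1 column_op_zero hperp_column_op)

interpretation e_product: column_family "\<lambda>m F. sym_e m * F"
  by standard (simp_all add: hperp_e_times)

lemma alternating_e_h:
  "(\<Sum>i\<le>n. scale_sym ((- 1) ^ i) (sym_e i * sym_h (n - i))) = (if n = 0 then 1 else 0)"
proof -
  define G where "G = (\<lambda>n. \<Sum>i\<le>n. scale_sym ((- 1) ^ i) (sym_e i * sym_h (n - i)))"
  have "G n = 0" if "n > 0"
  proof -
    have "hperp (Suc k) (G n) = 0" for k
    proof -
      \<comment> \<open>\<open>u\<^bsup>k+1\<^esup>\<close> arises either from \<open>h\<close> alone or with one factor \<open>u\<close> from \<open>e\<close>; the sum telescopes.\<close>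
      define t where "t = (\<lambda>i. if Suc k \<le> n - i
        then scale_sym ((- 1) ^ i) (sym_e i * sym_h (n - i - Suc k)) else 0)"
      have *: "hperp (Suc k) (sym_e i * F) = sym_e i * hperp (Suc k) F +
          (if i = 0 then 0 else sym_e (i - 1) * hperp k F)" for i F
        by (cases i) (simp_all add: hperp_e_times)
      have "hperp (Suc k) (scale_sym ((- 1) ^ i) (sym_e i * sym_h (n - i))) =
          t i - (if i = 0 then 0 else t (i - 1))" if "i \<le> n" for i
        using that by (cases i) (auto simp: t_def hperp_scale hperp_uminus * hperp_h sym.scale_right_distrib)
      then have "hperp (Suc k) (G n) = (\<Sum>i\<le>n. t i - (if i = 0 then 0 else t (i - 1)))"
        by (simp add: G_def hperp_sum)
      also have "\<dots> = t n"
        by (induction n) simp_all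
      also have "t n = 0" by (simp add: t_def)
      finally show ?thesis .
    qed
    then have "G n = scale_sym (sym_coeff (G n) {#}) 1"
      by (intro eq_const_if_hperp_zero) (metis gr0_implies_Suc)
    moreover have "sym_coeff (G n) {#} = 0"
    proof -
      have "{A. A = {#}} = {{#} :: nat multiset}" by auto
      then show ?thesis using that
        by (auto simp: G_def sym_coeff_sum sym_coeff_simps sym_coeff_times sym_coeff_h sym_coeff_e
            intro!: sum.neutral)
    qed
    ultimately show ?thesis by simp
  qed
  then show ?thesis by (auto simp: G_def)
qed

lemma sym_e_rec:
  "sym_e (Suc n) = (\<Sum>i\<le>n. scale_sym ((- 1) ^ (n + i)) (sym_e i * sym_h (Suc n - i)))"
proof -
  have "0 = scale_sym ((- 1) ^ n) (\<Sum>i\<le>Suc n. scale_sym ((- 1) ^ i) (sym_e i * sym_h (Suc n - i)))"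
    by (simp only: alternating_e_h) simp
  also have "\<dots> = (\<Sum>i\<le>n. scale_sym ((- 1) ^ (n + i)) (sym_e i * sym_h (Suc n - i))) - sym_e (Suc n)"
    by (simp add: sym.scale_sum_right sym.scale_right_diff_distrib power_add
        sym.scale_right_distrib del: diff_Suc_Suc flip: power_add)
  finally show ?thesis by simp
qed

text \<open>A monomial in \<open>u\<^sub>0 = 1, u\<^sub>1, u\<^sub>2, \<dots>\<close> only depends on the partition formed by its nonzero
  indices.\<close>

lemma prod_list_partition:
  fixes u :: "nat \<Rightarrow> 'a :: comm_monoid_mult"
  assumes "u 0 = 1"
  shows "prod_list (map u (rev (sort (filter (\<lambda>n. n \<noteq> 0) a)))) = prod_list (map u a)"
proof -
  have "prod_list (map u (rev (sort (filter (\<lambda>n. n \<noteq> 0) a)))) =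
      prod_list (map u (filter (\<lambda>n. n \<noteq> 0) a))"
    by (simp flip: prod_mset_prod_list)
  also have "\<dots> = prod_list (map u a)"
    by (induction a) (simp_all add: assms)
  finally show ?thesis .
qed

lemma rev_sort_filter_partition: "rev (sort (filter (\<lambda>n. n \<noteq> 0) a)) \<in> partitions"
  by (auto simp: partitions_def sorted_wrt_rev)

lemma e_product_col: "e_product.col a = prod_list (map sym_e a)"
  by (induction a) simp_all

lemma sym_e_induct:
  assumes "\<And>F G. P F \<Longrightarrow> P G \<Longrightarrow> P (F + G)" "\<And>F G. P F \<Longrightarrow> P G \<Longrightarrow> P (F * G)"
    and "\<And>c F. P F \<Longrightarrow> P (scale_sym c F)" "\<And>n. P (sym_e n)"
  shows "P F"
proof -
  have 1: "P (e_product.col a)" for a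
    using assms(4)[of 0] by (induction a) (auto intro: assms)
  have "F \<in> sym.span (e_product.col ` partitions)"
    by (simp add: e_product.span_col)
  then show ?thesis
  proof (induction rule: sym.span_induct_alt)
    case base
    show ?case using assms(3)[OF 1, of 0] by simp
  qed (auto intro: assms 1)
qed

lemma sym_h_induct [case_names add mult scale h]:
  assumes "\<And>F G. P F \<Longrightarrow> P G \<Longrightarrow> P (F + G)" "\<And>F G. P F \<Longrightarrow> P G \<Longrightarrow> P (F * G)"
    and "\<And>c F. P F \<Longrightarrow> P (scale_sym c F)" "\<And>n. P (sym_h n)"
  shows "P F"
proof (rule sym_e_induct[of P])
  have sum: "P (sum F A)" if "finite A" "\<And>x. x \<in> A \<Longrightarrow> P (F x)" for F :: "nat \<Rightarrow> sym" and A
    using that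
  proof (induction A rule: finite_induct)
    case empty
    show ?case using assms(3)[OF assms(4), of 0] by simp
  qed (auto intro: assms)
  show "P (sym_e n)" for n
  proof (induction n rule: less_induct)
    case (less n)
    show ?case
    proof (cases n)
      case 0
      then show ?thesis using assms(4)[of 0] by simp
    next
      case (Suc m)
      show ?thesis
        unfolding Suc sym_e_rec by (intro sum assms less.IH) (auto simp: Suc)
    qed
  qed
qed (auto intro: assms)

lemma sym_algebra_hom_simps:
  assumes "sym_algebra_hom U"
  shows "U 1 = 1" "U (F + G) = U F + U G" "U (F * G) = U F * U G"
    "U (scale_sym c F) = scale_sym c (U F)" "U 0 = 0"
proof -
  show "U 1 = 1" "U (F + G) = U F + U G" "U (F * G) = U F * U G"
    and 1: "U (scale_sym c F) = scale_sym c (U F)" for c F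
    using assms by (auto simp: sym_algebra_hom_def)
  from 1[of 0 0] show "U 0 = 0" by simp
qed

lemma sym_algebra_hom_sum: "sym_algebra_hom U \<Longrightarrow> U (sum F A) = (\<Sum>x\<in>A. U (F x))"
  by (induction A rule: infinite_finite_induct) (simp_all add: sym_algebra_hom_simps)

lemma sym_algebra_hom_eqI:
  assumes "sym_algebra_hom U" "sym_algebra_hom V" "\<And>n. U (sym_h n) = V (sym_h n)"
  shows "U F = V F"
  by (induction F rule: sym_h_induct) (simp_all add: assms sym_algebra_hom_simps)

text \<open>The \<open>e\<^sub>n\<close> with \<open>n \<ge> 1\<close> are algebraically independent: a homomorphism can be defined on the basis
  of their monomials.\<close>

lemma sym_algebra_hom_e_exists:
  assumes w0: "w 0 = (1 :: sym)"
  obtains V where "sym_algebra_hom V" "\<And>n. V (sym_e n) = w n"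
proof -
  interpret pair: vector_space_pair scale_sym scale_sym ..
  have basis: "basis_of_sym e_product.col"
    by (intro basis_of_symI e_product.span_col e_product.col_combination_eq_0)
  then obtain V where lin: "Vector_Spaces.linear scale_sym scale_sym V"
    and V: "\<forall>x\<in>e_product.col ` partitions.
      V x = prod_list (map w (inv_into partitions e_product.col x))"
    using pair.linear_independent_extend unfolding basis_of_sym_def by meson
  interpret V: Vector_Spaces.linear scale_sym scale_sym V by (rule lin)
  have partition: "V (e_product.col a) = prod_list (map w a)" if "a \<in> partitions" for a
    using that V basis by (simp add: basis_of_sym_def inv_into_f_f)
  have col: "V (e_product.col a) = prod_list (map w a)" for a
    using partition[OF rev_sort_filter_partition, of a] w0
    by (simp only: e_product_col prod_list_partition sym_e_0)
  have mult_col: "V (F * e_product.col b) = V F * V (e_product.col b)" for F b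
  proof -
    have "F \<in> sym.span (e_product.col ` partitions)" by (simp add: e_product.span_col)
    then show ?thesis
    proof (induction rule: sym.span_induct_alt)
      case (step c x y)
      then obtain a where "x = e_product.col a" by auto
      then have "x * e_product.col b = e_product.col (a @ b)" by (simp add: e_product_col)
      then have "V (x * e_product.col b) = V x * V (e_product.col b)"
        using \<open>x = e_product.col a\<close> by (simp add: col)
      with step show ?case
        by (simp add: ring_distribs scale_sym_mult V.add V.scale)
    qed simp
  qed
  have mult: "V (F * G) = V F * V G" for F G
  proof -
    have "G \<in> sym.span (e_product.col ` partitions)" by (simp add: e_product.span_col)
    then show ?thesis
    proof (induction rule: sym.span_induct_alt)
      case (step c x y)
      then show ?case
        by (auto simp: ring_distribs scale_sym_mult V.add V.scale mult_col)
    qed simp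
  qed
  have "sym_algebra_hom V"
    using mult col[of "[]"] by (simp add: sym_algebra_hom_def V.add V.scale)
  moreover have "V (sym_e n) = w n" for n
    using col[of "[n]"] by simp
  ultimately show ?thesis by (rule that)
qed

text \<open>The values at the \<open>e\<^sub>n\<close> forced on a homomorphism with values \<open>r\<^sub>n\<close> at the \<open>h\<^sub>n\<close>, by
  the recursion \<open>sym_e_rec\<close>.\<close>

fun e_from_h :: "(nat \<Rightarrow> sym) \<Rightarrow> nat \<Rightarrow> sym" where
  "e_from_h r 0 = 1"
| "e_from_h r (Suc n) = (\<Sum>i\<le>n. scale_sym ((- 1) ^ (n + i)) (e_from_h r i * r (Suc n - i)))"

lemma sym_algebra_hom_h_exists:
  assumes r0: "r 0 = (1 :: sym)"
  obtains V where "sym_algebra_hom V" "\<And>n. V (sym_h n) = r n"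
proof -
  obtain V where V: "sym_algebra_hom V" "\<And>n. V (sym_e n) = e_from_h r n"
    by (rule sym_algebra_hom_e_exists[of "e_from_h r"]) auto
  have "V (sym_h n) = r n" for n
  proof (induction n rule: less_induct)
    case (less n)
    show ?case
    proof (cases n)
      case 0
      then show ?thesis using V r0 by (simp add: sym_algebra_hom_simps)
    next
      case (Suc m)
      let ?t = "\<lambda>x i. scale_sym ((- 1) ^ (m + i)) (e_from_h r i * x)"
      have "(\<Sum>i\<le>m. ?t (r (n - i)) i) = V (sym_e n)"
        by (simp only: Suc V e_from_h.simps)
      also have "\<dots> = (\<Sum>i\<le>m. ?t (V (sym_h (n - i))) i)"
        unfolding Suc sym_e_rec sym_algebra_hom_sum[OF V(1)]
        by (simp only: sym_algebra_hom_simps[OF V(1)] V(2))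
      also have "\<dots> = (\<Sum>i\<in>{..m} - {0}. ?t (V (sym_h (n - i))) i) + ?t (V (sym_h n)) 0"
        by (subst sum.remove[of _ 0]) (simp_all add: add.commute)
      also have "(\<Sum>i\<in>{..m} - {0}. ?t (V (sym_h (n - i))) i) = (\<Sum>i\<in>{..m} - {0}. ?t (r (n - i)) i)"
        by (rule sum.cong) (auto simp: less Suc)
      finally have "?t (V (sym_h n)) 0 = ?t (r n) 0"
        by (subst (asm) sum.remove[of _ 0]) (simp_all add: add.commute)
      then show ?thesis by simp
    qed
  qed
  with V(1) show ?thesis by (rule that)
qed


section \<open>Umbral operators\<close>

lemma umbral_spec:
  assumes "delta_series f"
  shows "sym_algebra_hom (umbral f)"
    and "sym_coeff (umbral f (sym_h n)) M = (f ^ size M) $ n"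
proof -
  define r where "r = (\<lambda>n. Abs_sym (umbral_r f n))"
  have r: "mps_of_sym (r n) = umbral_r f n" for n
    using umbral_r_sym[OF assms] by (simp add: r_def Abs_sym_inverse)
  have coeff: "mcoeff (umbral_r f n) M = (f ^ size M) $ n" for n M
    by (simp add: umbral_r_def Mps_inverse size_multiset_overloaded_eq power_sum)
  have "r 0 = 1"
    using assms by (intro sym_eqI) (auto simp: r coeff sym_coeff_simps fps_power_zeroth delta_series_def
        simp flip: nonempty_has_size)
  then obtain V where V: "sym_algebra_hom V" "\<And>n. V (sym_h n) = r n"
    by (rule sym_algebra_hom_h_exists) blast
  have "\<exists>!U. sym_algebra_hom U \<and> (\<forall>n. mps_of_sym (U (sym_h n)) = umbral_r f n)"
  proof (rule ex1I)
    show "sym_algebra_hom V \<and> (\<forall>n. mps_of_sym (V (sym_h n)) = umbral_r f n)"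
      using V r by simp
  next
    fix W assume W: "sym_algebra_hom W \<and> (\<forall>n. mps_of_sym (W (sym_h n)) = umbral_r f n)"
    then have "W (sym_h n) = V (sym_h n)" for n
      by (metis V(2) r mps_of_sym_inject)
    then show "W = V" using W V(1) sym_algebra_hom_eqI by blast
  qed
  from theI'[OF this]
  show "sym_algebra_hom (umbral f)" "sym_coeff (umbral f (sym_h n)) M = (f ^ size M) $ n"
    by (simp_all add: coeff umbral_def)
qed

lemma umbral_h_expansion:
  assumes "delta_series f"
  shows "umbral f (sym_h n) = (\<Sum>k\<le>n. scale_sym ((f ^ k) $ n) (sym_h k))"
proof (rule sym_eqI)
  fix M
  have "(f ^ k) $ n = 0" if "n < k" for k
    using assms that by (simp add: delta_series_def startsby_zero_power_prefix)
  then show "sym_coeff (umbral f (sym_h n)) M =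
      sym_coeff (\<Sum>k\<le>n. scale_sym ((f ^ k) $ n) (sym_h k)) M"
    by (auto simp: umbral_spec(2)[OF assms] sym_coeff_sum sym_coeff_simps sym_coeff_h if_distrib
        sum.delta not_le cong: if_cong)
qed

lemma umbral_inverse:
  assumes f: "delta_series f" and g: "delta_series g" and gf: "fps_compose g f = fps_X"
  shows "umbral g (umbral f F) = F"
proof -
  note hom = umbral_spec(1)[OF f] umbral_spec(1)[OF g]
  have f0: "f $ 0 = 0" using f by (simp add: delta_series_def)
  have "umbral g (umbral f (sym_h n)) = sym_h n" for n
  proof (rule sym_eqI)
    fix M
    have "sym_coeff (umbral g (umbral f (sym_h n))) M = (\<Sum>k\<le>n. (f ^ k) $ n * (g ^ size M) $ k)"
      by (simp add: umbral_h_expansion[OF f] sym_algebra_hom_sum[OF hom(2)]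
          sym_algebra_hom_simps[OF hom(2)] sym_coeff_sum sym_coeff_simps umbral_spec(2)[OF g])
    also have "\<dots> = (fps_compose (g ^ size M) f) $ n"
      by (simp add: fps_compose_nth atLeast0AtMost mult.commute)
    also have "\<dots> = sym_coeff (sym_h n) M"
      by (simp add: fps_compose_power[OF f0, symmetric] gf sym_coeff_h fps_X_power_nth)
    finally show "sym_coeff (umbral g (umbral f (sym_h n))) M = sym_coeff (sym_h n) M" .
  qed
  then show ?thesis
    by (induction F rule: sym_h_induct) (simp_all add: sym_algebra_hom_simps[OF hom(1)]
        sym_algebra_hom_simps[OF hom(2)])
qed

text \<open>The factors \<open>U\<^sub>g \<circ> U\<^sub>f\<close> between consecutive conjugated column operators cancel, and
  so does the one in front of \<open>1 = U\<^sub>f[1]\<close>.\<close>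

lemma umbral_schur_eq:
  assumes f: "delta_series f" and g: "delta_series g" and gf: "fps_compose g f = fps_X"
  shows "umbral_schur f g l = umbral f (column.col (conj_partition l))"
proof -
  have "foldr (\<lambda>m. umbral_column_op f g (int m)) a 1 = umbral f (column.col a)" for a
    by (induction a) (simp_all add: umbral_column_op_def umbral_inverse[OF f g gf]
        sym_algebra_hom_simps[OF umbral_spec(1)[OF f]])
  then show ?thesis by (simp add: umbral_schur_def)
qed


section \<open>Conjugate partitions and horizontal strips\<close>

text \<open>Rows are weakly decreasing lists in which trailing zeros are allowed, so that the rows
  of a tableau may become empty.  \<open>columns n l\<close> lists the lengths of the first \<open>n\<close> columns.\<close>

definition columns :: "nat \<Rightarrow> nat list \<Rightarrow> nat list"
  where "columns n l = map (\<lambda>j. length (filter (\<lambda>a. j < a) l)) [0..<n]"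

lemma length_columns [simp]: "length (columns n l) = n"
  by (simp add: columns_def)

lemma conj_partition_columns: "conj_partition l = columns (if l = [] then 0 else hd l) l"
  by (simp add: conj_partition_def columns_def)

lemma less_length_filter_iff:
  fixes l :: "nat list"
  assumes "sorted_wrt (\<ge>) l"
  shows "i < length (filter (\<lambda>a. j < a) l) \<longleftrightarrow> i < length l \<and> j < l ! i"
  using assms
proof (induction l arbitrary: i)
  case (Cons x l)
  show ?case
  proof (cases "j < x")
    case True
    with Cons show ?thesis by (cases i) auto
  next
    case False
    have le: "y \<le> x" if "y \<in> set (x # l)" for y
      using that Cons.prems by auto
    with False have "\<not> j < y" if "y \<in> set (x # l)" for y
      using that by fastforce
    then have "filter (\<lambda>a. j < a) (x # l) = []" "i < length (x # l) \<Longrightarrow> \<not> j < (x # l) ! i"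
      unfolding filter_empty_conv using nth_mem by blast+
    then show ?thesis by (metis list.size(3) not_less_zero)
  qed
qed simp

text \<open>Both sides say that the cell in row \<open>i\<close> and column \<open>j\<close> lies in the diagram.\<close>

lemma less_columns_iff:
  "sorted_wrt (\<ge>) l \<Longrightarrow> j < n \<Longrightarrow> i < columns n l ! j \<longleftrightarrow> i < length l \<and> j < l ! i"
  by (simp add: columns_def less_length_filter_iff)

lemma length_filter_mono:
  assumes "\<And>x. x \<in> set xs \<Longrightarrow> P x \<Longrightarrow> Q x"
  shows "length (filter P xs) \<le> length (filter Q xs)"
proof -
  have "filter P xs = filter P (filter Q xs)"
    unfolding filter_filter using assms by (intro filter_cong) auto
  then show ?thesis by (metis length_filter_le)
qed

lemma sorted_columns: "sorted_wrt (\<ge>) (columns n l)"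
  by (auto simp: columns_def sorted_wrt_iff_nth_less intro!: length_filter_mono)

lemma nat_eqI_less: "(\<And>i. i < x \<longleftrightarrow> i < y) \<Longrightarrow> x = (y :: nat)"
  by (meson linorder_neqE_nat less_irrefl)

lemma columns_columns:
  assumes "sorted_wrt (\<ge>) l" "\<forall>x\<in>set l. x \<le> n"
  shows "columns (length l) (columns n l) = l"
proof (rule nth_equalityI)
  fix i assume "i < length (columns (length l) (columns n l))"
  then have i: "i < length l" by simp
  with assms(2) have "l ! i \<le> n" by simp
  show "columns (length l) (columns n l) ! i = l ! i"
  proof (rule nat_eqI_less)
    fix j
    show "j < columns (length l) (columns n l) ! i \<longleftrightarrow> j < l ! i"
      using less_columns_iff[OF sorted_columns i, of j n l] less_columns_iff[OF assms(1), of j n i]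
        i \<open>l ! i \<le> n\<close> by auto
  qed
qed simp

lemma sum_list_columns:
  "\<forall>x\<in>set l. x \<le> n \<Longrightarrow> sum_list (columns n l) = sum_list l"
proof (induction l)
  case (Cons x l)
  have "sum_list (columns n (x # l)) = (\<Sum>j<n. if j < x then 1 else 0) + sum_list (columns n l)"
    by (simp add: columns_def interv_sum_list_conv_sum_set_nat atLeast0LessThan flip: sum.distrib)
      (rule sum.cong; simp)
  also have "(\<Sum>j<n. if j < x then 1 else 0) = card ({..<n} \<inter> {j. j < x})"
    by (simp add: sum.If_cases)
  also have "{..<n} \<inter> {j. j < x} = {..<x}" using Cons.prems by auto
  finally show ?case using Cons by simp
qed (simp add: columns_def sum_list_0)

lemma le_hd_if_sorted: "sorted_wrt (\<ge>) l \<Longrightarrow> x \<in> set l \<Longrightarrow> x \<le> hd (l :: nat list)"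
  by (cases l) auto

lemma columns_eq_conj_partition_append:
  assumes "sorted_wrt (\<ge>) l" "\<forall>x\<in>set l. x \<le> n"
  shows "columns n l = conj_partition l @ replicate (n - (if l = [] then 0 else hd l)) 0"
proof -
  define h where "h = (if l = [] then 0 else hd l)"
  have "h \<le> n" using assms(2) by (auto simp: h_def)
  have h: "x \<le> h" if "x \<in> set l" for x
    using le_hd_if_sorted[OF assms(1) that] that by (auto simp: h_def)
  have "length (filter (\<lambda>a. j < a) l) = 0" if "j \<ge> h" for j
  proof -
    have "\<not> j < x" if "x \<in> set l" for x using h[OF that] \<open>j \<ge> h\<close> by simp
    then show ?thesis by simp
  qed
  then have "map (\<lambda>j. length (filter (\<lambda>a. j < a) l)) [h..<n] = replicate (n - h) 0"
    by (intro replicate_eqI) auto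
  moreover have "[0..<n] = [0..<h] @ [h..<n]"
    using \<open>h \<le> n\<close> upt_add_eq_append[of 0 h "n - h"] by simp
  ultimately show ?thesis
    by (simp add: conj_partition_columns columns_def flip: h_def)
qed

lemma col_columns:
  assumes "sorted_wrt (\<ge>) l" "\<forall>x\<in>set l. x \<le> n"
  shows "column.col (columns n l) = column.col (conj_partition l)"
  unfolding columns_eq_conj_partition_append[OF assms] by (rule column.col_append_zeros)

lemma conj_partition_pos: "sorted_wrt (\<ge>) l \<Longrightarrow> 0 \<notin> set (conj_partition l)"
  by (cases l) (auto simp: conj_partition_def)

lemma conj_partition_partition: "l \<in> partitions \<Longrightarrow> conj_partition l \<in> partitions"
  unfolding partitions_def
  by (auto simp: conj_partition_pos) (simp add: conj_partition_columns sorted_columns)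

lemma conj_partition_conj_partition:
  assumes "l \<in> partitions"
  shows "conj_partition (conj_partition l) = l"
proof (cases l)
  case (Cons x m)
  have x: "x > 0" and l: "sorted_wrt (\<ge>) l" using assms Cons by (auto simp: partitions_def)
  have "filter (\<lambda>a. 0 < a) l = l"
    using assms by (auto simp: filter_id_conv partitions_def intro: gr0I)
  then have "hd (columns x l) = length l" "columns x l \<noteq> []"
    using x by (simp_all add: columns_def hd_map)
  then have "conj_partition (columns x l) = columns (length l) (columns x l)"
    by (simp add: conj_partition_columns[of "columns x l"])
  also have "\<dots> = l" using l le_hd_if_sorted[OF l] Cons by (intro columns_columns) auto
  finally show ?thesis using Cons conj_partition_columns[of l] by simp
qed (simp add: conj_partition_def)

lemma column_op_add: "column_op (int m) (F + G) = column_op (int m) F + column_op (int m) G"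
proof -
  obtain d e where "\<forall>k>d. hperp k F = 0" "\<forall>k>e. hperp k G = 0"
    using hperp_eventually_zero by metis
  then have d: "\<forall>k>max d e. hperp k F = 0" "\<forall>k>max d e. hperp k G = 0" by auto
  then have "\<forall>k>max d e. hperp k (F + G) = 0" by (simp add: hperp_add)
  from column_op_eq[OF this] column_op_eq[OF d(1)] column_op_eq[OF d(2)] show ?thesis
    by (simp add: hperp_add ring_distribs sum.distrib)
qed

lemma column_op_sum: "column_op (int m) (sum F A) = (\<Sum>x\<in>A. column_op (int m) (F x))"
  by (induction A rule: infinite_finite_induct) (simp_all add: column_op_add column_op_zero)

text \<open>\<open>lowering a b\<close>: the column lengths \<open>b\<close> arise from \<open>a\<close> by removing at most one cell from each
  column.  They need not be weakly decreasing.\<close>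

abbreviation lowering :: "nat list \<Rightarrow> nat list \<Rightarrow> bool"
  where "lowering \<equiv> list_all2 (\<lambda>x y. y \<le> x \<and> x \<le> Suc y)"

text \<open>Those with \<open>k\<close> cells removed in total.\<close>

definition lowerings :: "nat list \<Rightarrow> nat \<Rightarrow> nat list set"
  where "lowerings a k = {b. lowering a b \<and> sum_list a = sum_list b + k}"

lemma sum_list_lowering: "lowering a b \<Longrightarrow> sum_list b \<le> sum_list a"
  by (induction rule: list_all2_induct) auto

lemma lowerings_Cons:
  "lowerings (Suc m # a) k =
    (#) (Suc m) ` lowerings a k \<union> (if k = 0 then {} else (#) m ` lowerings a (k - 1))"
  (is "?L = ?R")
proof
  show "?R \<subseteq> ?L" by (auto simp: lowerings_def)
  show "?L \<subseteq> ?R"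
  proof
    fix b assume "b \<in> ?L"
    then obtain y b' where b: "b = y # b'" "y \<le> Suc m" "m \<le> y" "lowering a b'"
      "Suc m + sum_list a = y + sum_list b' + k"
      by (auto simp: lowerings_def list_all2_Cons1)
    then consider "y = m" "k > 0" | "y = Suc m"
      using sum_list_lowering[of a b'] by force
    then show "b \<in> ?R" by cases (use b in \<open>auto simp: lowerings_def\<close>)
  qed
qed

lemma finite_lowerings: "finite (lowerings a k)"
proof (rule finite_subset)
  show "lowerings a k \<subseteq> {b. set b \<subseteq> {..sum_list a} \<and> length b = length a}"
    using member_le_sum_list sum_list_lowering
    by (fastforce simp: lowerings_def dest: list_all2_lengthD intro: order_trans)
  show "finite {b. set b \<subseteq> {..sum_list a} \<and> length b = length a}"
    by (rule finite_lists_length_eq) simp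
qed

lemma hperp_col_lowerings:
  "0 \<notin> set a \<Longrightarrow> hperp k (column.col a) = sum column.col (lowerings a k)"
proof (induction a arbitrary: k)
  case Nil
  have "lowerings [] k = (if k = 0 then {[]} else {})"
    by (auto simp: lowerings_def)
  then show ?case by (simp add: hperp_1)
next
  case (Cons m a)
  then obtain m' where m: "m = Suc m'" by (metis list.set_intros(1) not0_implies_Suc)
  show ?case
  proof (cases k)
    case 0
    then show ?thesis
      using Cons.IH[of 0] Cons.prems
      unfolding m lowerings_Cons by (simp add: sum.reindex column_op_sum del: of_nat_Suc)
  next
    case (Suc k')
    have "hperp k (column.col (m # a)) = column_op (int m) (hperp k (column.col a))
        + column_op (int m') (hperp k' (column.col a))"
      by (simp only: Suc m column.col_simps hperp_column_op)
    also have "hperp k (column.col a) = sum column.col (lowerings a k)"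
      using Cons by simp
    also have "hperp k' (column.col a) = sum column.col (lowerings a k')"
      using Cons by simp
    also have "column_op (int m) (sum column.col (lowerings a k))
        + column_op (int m') (sum column.col (lowerings a k')) =
        sum column.col ((#) m ` lowerings a k \<union> (#) m' ` lowerings a k')"
      by (subst sum.union_disjoint)
        (auto simp: finite_lowerings sum.reindex column_op_sum m simp del: of_nat_Suc)
    also have "(#) m ` lowerings a k \<union> (#) m' ` lowerings a k' = lowerings (m # a) k"
      unfolding m lowerings_Cons by (simp add: Suc)
    finally show ?thesis .
  qed
qed

text \<open>If the result of a lowering is not weakly decreasing, two adjacent columns have lengths \<open>y\<close> and
  \<open>y + 1\<close>, and \<open>column_op_Suc_eq_0\<close> applies.\<close>

lemma col_lowering_unsorted:
  "lowering a b \<Longrightarrow> sorted_wrt (\<ge>) a \<Longrightarrow> \<not> sorted_wrt (\<ge>) b \<Longrightarrow> column.col b = 0"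
proof (induction rule: list_all2_induct)
  case (Cons x a y b)
  show ?case
  proof (cases "sorted_wrt (\<ge>) b")
    case False
    with Cons have "column.col b = 0" by simp
    then show ?thesis by (simp add: column_op_zero)
  next
    case True
    then obtain z b' where b: "b = z # b'"
      using Cons.prems by (cases b) auto
    then obtain w a' where a: "a = w # a'" "z \<le> w"
      using Cons.hyps by (auto simp: list_all2_Cons2)
    have "\<not> z \<le> y"
      using True Cons.prems(2) b by (auto dest: order_trans)
    then have "z = Suc y" using Cons.hyps(1) Cons.prems(1) a by auto
    then show ?thesis by (simp add: b column_op_Suc_eq_0 del: of_nat_Suc)
  qed
qed simp

text \<open>The row lengths \<open>m\<close>, as many as in \<open>l\<close>, such that \<open>l/m\<close> is a horizontal strip of size \<open>k\<close>.\<close>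

definition strips :: "nat list \<Rightarrow> nat \<Rightarrow> nat list set"
  where "strips l k = {m. length m = length l \<and> (\<forall>i<length l. m ! i \<le> l ! i) \<and>
    (\<forall>i. Suc i < length l \<longrightarrow> l ! Suc i \<le> m ! i) \<and> sum_list l = sum_list m + k}"

lemma strips_sorted:
  assumes "m \<in> strips l k"
  shows "sorted_wrt (\<ge>) m"
proof (subst sorted_wrt_iff_nth_Suc_transp)
  show "transp ((\<ge>) :: nat \<Rightarrow> _)" by (auto intro: transpI)
  show "\<forall>i. Suc i < length m \<longrightarrow> m ! Suc i \<le> m ! i"
  proof (intro allI impI)
    fix i assume "Suc i < length m"
    with assms have "m ! Suc i \<le> l ! Suc i" "l ! Suc i \<le> m ! i" by (auto simp: strips_def)
    then show "m ! Suc i \<le> m ! i" by (rule order_trans)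
  qed
qed

lemma finite_strips: "finite (strips l k)"
proof (rule finite_subset)
  show "strips l k \<subseteq> {m. set m \<subseteq> {..sum_list l} \<and> length m = length l}"
    using member_le_sum_list by (fastforce simp: strips_def)
  show "finite {m. set m \<subseteq> {..sum_list l} \<and> length m = length l}"
    by (rule finite_lists_length_eq) simp
qed

lemma bij_betw_strips_lowerings:
  assumes l: "sorted_wrt (\<ge>) l" and n: "\<forall>x\<in>set l. x \<le> n"
  shows "bij_betw (columns n) (strips l k)
    {b \<in> lowerings (columns n l) k. sorted_wrt (\<ge>) b}"
    (is "bij_betw _ _ ?B")
proof (rule bij_betw_byWitness[where f' = "columns (length l)"])
  have m: "sorted_wrt (\<ge>) m" "\<forall>x\<in>set m. x \<le> n" "length m = length l" if "m \<in> strips l k" for m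
    using that n strips_sorted unfolding strips_def
    by (auto simp: all_set_conv_all_nth intro: order_trans)
  show "\<forall>m\<in>strips l k. columns (length l) (columns n m) = m"
    using m columns_columns by metis
  have b: "length b = n" "\<forall>x\<in>set b. x \<le> length l" "sorted_wrt (\<ge>) b" "lowering (columns n l) b"
    if "b \<in> ?B" for b
  proof -
    show *: "length b = n" "lowering (columns n l) b" "sorted_wrt (\<ge>) b"
      using that by (auto simp: lowerings_def dest: list_all2_lengthD)
    show "\<forall>x\<in>set b. x \<le> length l"
      using * by (auto simp: all_set_conv_all_nth list_all2_conv_all_nth columns_def
          intro: order_trans length_filter_le)
  qed
  show "\<forall>b\<in>?B. columns n (columns (length l) b) = b"
    using b columns_columns by metis
  show "columns n ` strips l k \<subseteq> ?B"
  proof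
    fix b assume "b \<in> columns n ` strips l k"
    then obtain m where b: "b = columns n m" "m \<in> strips l k" by auto
    have "b ! j \<le> columns n l ! j \<and> columns n l ! j \<le> Suc (b ! j)" if j: "j < n" for j
    proof
      show "b ! j \<le> columns n l ! j"
      proof (rule ccontr)
        assume "\<not> b ! j \<le> columns n l ! j"
        then show False
          using less_columns_iff[OF m(1)[OF b(2)] j, of "columns n l ! j"]
            less_columns_iff[OF l j, of "columns n l ! j"] b m(3)[OF b(2)]
          by (auto simp: strips_def)
      qed
      show "columns n l ! j \<le> Suc (b ! j)"
      proof (rule ccontr)
        assume "\<not> columns n l ! j \<le> Suc (b ! j)"
        then show False
          using less_columns_iff[OF m(1)[OF b(2)] j, of "b ! j"]
            less_columns_iff[OF l j, of "Suc (b ! j)"] b m(3)[OF b(2)]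
          by (auto simp: strips_def)
      qed
    qed
    moreover have "sum_list (columns n l) = sum_list b + k"
      using b m(2)[OF b(2)] n by (simp add: sum_list_columns strips_def)
    ultimately show "b \<in> ?B"
      using b by (auto simp: lowerings_def list_all2_conv_all_nth sorted_columns)
  qed
  show "columns (length l) ` ?B \<subseteq> strips l k"
  proof
    fix m assume "m \<in> columns (length l) ` ?B"
    then obtain c where c: "c \<in> ?B" and m: "m = columns (length l) c" by auto
    note bc = b[OF c]
    have lower: "c ! j \<le> columns n l ! j" "columns n l ! j \<le> Suc (c ! j)" if "j < n" for j
      using bc(4) that by (auto simp: list_all2_conv_all_nth)
    have le: "m ! i \<le> l ! i" if i: "i < length l" for i
    proof (rule ccontr)
      assume "\<not> m ! i \<le> l ! i"
      then have j: "l ! i < n" "i < c ! (l ! i)"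
        using less_columns_iff[OF bc(3) i, of "l ! i"] m bc(1) by auto
      then have "i < columns n l ! (l ! i)" using lower(1)[of "l ! i"] by simp
      then show False using less_columns_iff[OF l j(1), of i] by simp
    qed
    have ge: "l ! Suc i \<le> m ! i" if i: "Suc i < length l" for i
    proof (rule ccontr)
      assume "\<not> l ! Suc i \<le> m ! i"
      then have j: "m ! i < l ! Suc i" by simp
      moreover have "l ! Suc i \<le> n" using n i by simp
      ultimately have jn: "m ! i < n" by simp
      have "Suc i < columns n l ! (m ! i)" using less_columns_iff[OF l jn] i j by simp
      then have "i < c ! (m ! i)" using lower(2)[OF jn] by simp
      then show False using less_columns_iff[OF bc(3), of i "length l" "m ! i"] i jn m bc(1) by simp
    qed
    have "sum_list m = sum_list c"
      unfolding m by (rule sum_list_columns[OF bc(2)])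
    then have "sum_list l = sum_list m + k"
      using c n by (simp add: lowerings_def sum_list_columns)
    then show "m \<in> strips l k"
      using le ge by (simp add: strips_def m)
  qed
qed

text \<open>The Pieri rule in its dual form.\<close>

lemma hperp_col_strips:
  assumes l: "sorted_wrt (\<ge>) l"
  shows "hperp k (column.col (conj_partition l)) = (\<Sum>m\<in>strips l k. column.col (conj_partition m))"
proof -
  define n where "n = (if l = [] then 0 else hd l)"
  define a where "a = columns n l"
  have n: "\<forall>x\<in>set l. x \<le> n" using le_hd_if_sorted[OF l] by (auto simp: n_def)
  have a: "conj_partition l = a" by (simp add: a_def n_def conj_partition_columns)
  have "hperp k (column.col a) = sum column.col (lowerings a k)"
    using conj_partition_pos[OF l] a by (intro hperp_col_lowerings) simp
  also have "\<dots> = sum column.col {b \<in> lowerings a k. sorted_wrt (\<ge>) b}"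
    using col_lowering_unsorted[of a] sorted_columns[of n l]
    by (intro sum.mono_neutral_right finite_lowerings) (auto simp: a_def lowerings_def)
  also have "\<dots> = (\<Sum>m\<in>strips l k. column.col (columns n m))"
    unfolding a_def by (rule sum.reindex_bij_betw[OF bij_betw_strips_lowerings[OF l n], symmetric])
  also have "\<dots> = (\<Sum>m\<in>strips l k. column.col (conj_partition m))"
  proof (rule sum.cong[OF refl])
    fix m assume m: "m \<in> strips l k"
    then have "\<forall>x\<in>set m. x \<le> n"
      using n by (auto simp: strips_def all_set_conv_all_nth intro: order_trans)
    then show "column.col (columns n m) = column.col (conj_partition m)"
      by (rule col_columns[OF strips_sorted[OF m]])
  qed
  finally show ?thesis by (simp add: a)
qed


section \<open>Semistandard tableaux and Schur functions\<close>

lemma sorted_eq_filter_append: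
  "sorted r \<Longrightarrow> \<forall>x\<in>set r. x \<le> a \<Longrightarrow>
    r = filter (\<lambda>x. x \<noteq> a) r @ replicate (length r - length (filter (\<lambda>x. x \<noteq> a) r)) (a :: nat)"
proof (induction r)
  case (Cons x r)
  show ?case
  proof (cases "x = a")
    case True
    with Cons.prems have "\<forall>y\<in>set r. y = a" by (auto intro: antisym)
    then have "filter (\<lambda>x. x \<noteq> a) r = []" "replicate (length r) a = r"
      by (auto simp: filter_empty_conv intro: replicate_eqI[symmetric])
    with True show ?thesis by simp
  next
    case False
    have "length (x # r) - length (filter (\<lambda>x. x \<noteq> a) (x # r)) =
        length r - length (filter (\<lambda>x. x \<noteq> a) r)"
      using False by simp
    with False Cons show ?thesis by simp
  qed
qed simp

lemma mset_split:
  "M = filter_mset (\<lambda>x. x \<noteq> a) M + replicate_mset (count M a) a"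
  by (auto simp: multiset_eq_iff)

lemma mset_concat_filter:
  "mset (concat (map (filter P) T)) = filter_mset P (mset (concat T))"
  by (simp flip: filter_concat mset_filter)

text \<open>The tableaux of shape \<open>l\<close> and content \<open>M\<close>.\<close>

definition tableaux :: "nat list \<Rightarrow> nat multiset \<Rightarrow> nat list list set"
  where "tableaux l M = {T \<in> ssyt l. mset (concat T) = M}"

text \<open>Fills up the rows of \<open>T\<close> with \<open>a\<close> to obtain row lengths \<open>l\<close>.\<close>

definition fill_rows :: "nat \<Rightarrow> nat list \<Rightarrow> nat list list \<Rightarrow> nat list list"
  where "fill_rows a l T = map (\<lambda>i. T ! i @ replicate (l ! i - length (T ! i)) a) [0..<length l]"

lemma tableauxD:
  assumes "T \<in> tableaux l M"
  shows "length T = length l" "\<And>i. i < length l \<Longrightarrow> length (T ! i) = l ! i"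
    "\<And>i. i < length l \<Longrightarrow> sorted (T ! i)"
    "\<And>i j. Suc i < length l \<Longrightarrow> j < l ! Suc i \<Longrightarrow> T ! i ! j < T ! Suc i ! j"
    "mset (concat T) = M" "\<And>i x. i < length l \<Longrightarrow> x \<in> set (T ! i) \<Longrightarrow> x \<in># M"
    "sum_list l = size M"
proof -
  have T: "map length T = l" "\<forall>row\<in>set T. sorted row" "mset (concat T) = M"
    "\<forall>i j. Suc i < length T \<longrightarrow> j < length (T ! Suc i) \<longrightarrow> T ! i ! j < T ! Suc i ! j"
    using assms by (auto simp: tableaux_def ssyt_def)
  show 1: "length T = length l" using T(1) by auto
  show 2: "length (T ! i) = l ! i" if "i < length l" for i
    using T(1) that by auto
  show "sorted (T ! i)" if "i < length l" for i
    using T(2) that 1 by simp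
  show "T ! i ! j < T ! Suc i ! j" if "Suc i < length l" "j < l ! Suc i" for i j
    using T(4) that 1 2 by simp
  show "mset (concat T) = M" by (rule T(3))
  show "x \<in># M" if "i < length l" "x \<in> set (T ! i)" for i x
  proof -
    have "x \<in> set (concat T)" using that 1 by (auto simp: in_set_conv_nth intro!: bexI[of _ "T ! i"])
    then show ?thesis using T(3) by (metis set_mset_mset)
  qed
  show "sum_list l = size M"
    using T(1,3) by (metis length_concat size_mset)
qed

lemma tableauxI:
  assumes "length T = length l" "\<And>i. i < length l \<Longrightarrow> length (T ! i) = l ! i"
    "\<And>i. i < length l \<Longrightarrow> sorted (T ! i)"
    "\<And>i j. Suc i < length l \<Longrightarrow> j < l ! Suc i \<Longrightarrow> T ! i ! j < T ! Suc i ! j"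
    "mset (concat T) = M"
  shows "T \<in> tableaux l M"
proof -
  have "map length T = l" by (rule nth_equalityI) (use assms(1,2) in auto)
  moreover have "\<forall>row\<in>set T. sorted row" using assms(1,3) by (auto simp: in_set_conv_nth)
  ultimately show ?thesis using assms by (auto simp: tableaux_def ssyt_def)
qed

lemma fill_rows_filter:
  assumes T: "T \<in> tableaux l M" and a: "\<forall>x\<in>#M. x \<le> a"
  shows "fill_rows a l (map (filter (\<lambda>x. x \<noteq> a)) T) = T"
proof (rule nth_equalityI)
  fix i assume "i < length (fill_rows a l (map (filter (\<lambda>x. x \<noteq> a)) T))"
  then have i: "i < length l" by (simp add: fill_rows_def)
  have "\<forall>x\<in>set (T ! i). x \<le> a" using tableauxD(6)[OF T i] a by blast
  from sorted_eq_filter_append[OF tableauxD(3)[OF T i] this]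
  show "fill_rows a l (map (filter (\<lambda>x. x \<noteq> a)) T) ! i = T ! i"
    using i tableauxD(1,2)[OF T] by (simp add: fill_rows_def)
qed (simp add: fill_rows_def tableauxD(1)[OF T])

text \<open>Removing the largest entries removes a horizontal strip, as they occupy the ends of the rows
  and no two of them lie in the same column.\<close>

lemma filter_tableau:
  assumes l: "sorted_wrt (\<ge>) l" and T: "T \<in> tableaux l M" and a: "\<forall>x\<in>#M. x \<le> a"
  defines "T' \<equiv> map (filter (\<lambda>x. x \<noteq> a)) T"
  shows "map length T' \<in> strips l (count M a)"
    and "T' \<in> tableaux (map length T') (filter_mset (\<lambda>x. x \<noteq> a) M)"
proof -
  note D = tableauxD[OF T]
  define m where "m = map length T'"
  have len: "length T' = length l" "length m = length l" using D(1) by (simp_all add: T'_def m_def)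
  have m_le: "m ! i \<le> l ! i" if "i < length l" for i
    using D(1) D(2)[OF that] that length_filter_le[of _ "T ! i"] by (simp add: m_def T'_def)
  have row: "T ! i = T' ! i @ replicate (l ! i - m ! i) a" if i: "i < length l" for i
    using arg_cong[OF fill_rows_filter[OF T a], of "\<lambda>T. T ! i"] i D(1)
    by (simp add: fill_rows_def m_def T'_def)
  have m_nth: "length (T' ! i) = m ! i" if "i < length l" for i
    using that D(1) by (simp add: m_def T'_def)
  have dec: "l ! Suc i \<le> l ! i" if "Suc i < length l" for i
    using l that by (simp add: sorted_wrt_iff_nth_less)
  have m_ge: "l ! Suc i \<le> m ! i" if i: "Suc i < length l" for i
  proof (rule ccontr)
    assume "\<not> l ! Suc i \<le> m ! i"
    then have j: "m ! i < l ! Suc i" by simp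
    have "T ! i ! (m ! i) = a"
      using row[of i] i j dec[OF i] m_nth[of i] by (simp add: nth_append)
    moreover have "T ! Suc i ! (m ! i) \<le> a"
      using a D(6)[OF i] D(2)[OF i] j by simp
    ultimately show False using D(4)[OF i j] by simp
  qed
  have mset': "mset (concat T') = filter_mset (\<lambda>x. x \<noteq> a) M"
    unfolding T'_def mset_concat_filter D(5) ..
  have "sum_list m = size (filter_mset (\<lambda>x. x \<noteq> a) M)"
    unfolding mset'[symmetric] by (simp add: m_def length_concat)
  then have "sum_list l = sum_list m + count M a"
    using D(7) arg_cong[OF mset_split[of M a], of size] by simp
  then show "map length T' \<in> strips l (count M a)"
    using m_le m_ge len by (simp add: strips_def flip: m_def)
  show "T' \<in> tableaux (map length T') (filter_mset (\<lambda>x. x \<noteq> a) M)"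
  proof (rule tableauxI)
    fix i j assume ij: "Suc i < length (map length T')" "j < map length T' ! Suc i"
    then have i: "Suc i < length l" and j: "j < m ! Suc i" using len by (simp_all add: m_def)
    have "T ! i ! j = T' ! i ! j" "T ! Suc i ! j = T' ! Suc i ! j" "j < l ! Suc i"
      using row[of i] row[OF i] m_nth[of i] m_nth[OF i] j m_le[OF i] m_ge[OF i] i
      by (simp_all add: nth_append)
    with D(4)[OF i, of j] show "T' ! i ! j < T' ! Suc i ! j" by simp
  qed (use D(1,3) len mset' in \<open>auto simp: T'_def sorted_filter[of "\<lambda>x. x", simplified]\<close>)
qed

lemma fill_rows_tableau:
  assumes m: "m \<in> strips l k" and T': "T' \<in> tableaux m M'" and a: "\<forall>x\<in>#M'. x < a"
  shows "fill_rows a l T' \<in> tableaux l (M' + replicate_mset k a)"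
    and "map (filter (\<lambda>x. x \<noteq> a)) (fill_rows a l T') = T'"
proof -
  note D = tableauxD[OF T']
  define T where "T = fill_rows a l T'"
  have len: "length m = length l" "length T = length l"
    using m by (simp_all add: strips_def T_def fill_rows_def)
  have row: "T ! i = T' ! i @ replicate (l ! i - m ! i) a" if "i < length l" for i
    using that len D(2) by (simp add: T_def fill_rows_def)
  have less: "x < a" if "i < length l" "x \<in> set (T' ! i)" for i x
    using a D(6) that len by simp
  have rows: "length (T ! i) = l ! i" "sorted (T ! i)" if i: "i < length l" for i
    using row[OF i] D(2,3)[of i] i len m less[OF i]
    by (auto simp: strips_def sorted_append intro: less_imp_le)
  have cols: "T ! i ! j < T ! Suc i ! j" if i: "Suc i < length l" and j: "j < l ! Suc i" for i j
  proof -
    have "l ! Suc i \<le> m ! i" using m i by (simp add: strips_def)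
    then have ij: "T ! i ! j = T' ! i ! j" "j < m ! i"
      using row[of i] i j D(2)[of i] len by (simp_all add: nth_append)
    show ?thesis
    proof (cases "j < m ! Suc i")
      case True
      then have "T ! Suc i ! j = T' ! Suc i ! j"
        using row[OF i] D(2)[of "Suc i"] i len by (simp add: nth_append)
      with ij D(4)[of i j] True i len show ?thesis by simp
    next
      case False
      then have "T ! Suc i ! j = a"
        using row[OF i] D(2)[of "Suc i"] i len j by (simp add: nth_append)
      moreover have "T' ! i ! j \<in> set (T' ! i)" using ij D(2)[of i] i len by simp
      ultimately show ?thesis using less[of i] ij i by simp
    qed
  qed
  show filter: "map (filter (\<lambda>x. x \<noteq> a)) (fill_rows a l T') = T'"
    unfolding T_def[symmetric]
  proof (rule nth_equalityI)
    fix i assume "i < length (map (filter (\<lambda>x. x \<noteq> a)) T)"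
    then have i: "i < length l" using len by simp
    have "filter (\<lambda>x. x \<noteq> a) (T' ! i) = T' ! i"
      using less[OF i] by (auto simp: filter_id_conv)
    then show "map (filter (\<lambda>x. x \<noteq> a)) T ! i = T' ! i"
      using i len row[OF i] by simp
  qed (use D(1) len in simp)
  define X where "X = mset (concat T)"
  have X: "filter_mset (\<lambda>x. x \<noteq> a) X = M'"
    using mset_concat_filter[of "\<lambda>x. x \<noteq> a" T] filter D(5) by (simp add: X_def T_def)
  have "map length T = l" by (rule nth_equalityI) (use rows len in auto)
  then have "size X = sum_list l" by (metis X_def length_concat size_mset)
  also have "\<dots> = size M' + k" using m D(7) by (simp add: strips_def)
  finally have "X = M' + replicate_mset k a"
    using mset_split[of X a] X arg_cong[OF mset_split[of X a], of size] by simp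
  then show "fill_rows a l T' \<in> tableaux l (M' + replicate_mset k a)"
    unfolding T_def[symmetric] X_def by (intro tableauxI) (use len rows cols in auto)
qed

lemma bij_betw_tableaux:
  assumes l: "sorted_wrt (\<ge>) l" and a: "\<forall>x\<in>#M. x \<le> a"
  shows "bij_betw (map (filter (\<lambda>x. x \<noteq> a))) (tableaux l M)
    (\<Union>m\<in>strips l (count M a). tableaux m (filter_mset (\<lambda>x. x \<noteq> a) M))"
proof (rule bij_betw_byWitness[where f' = "fill_rows a l"])
  let ?M = "filter_mset (\<lambda>x. x \<noteq> a) M"
  have less: "\<forall>x\<in>#?M. x < a" using a by (auto simp: le_neq_implies_less)
  show "\<forall>T\<in>tableaux l M. fill_rows a l (map (filter (\<lambda>x. x \<noteq> a)) T) = T"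
    using fill_rows_filter a by blast
  show "\<forall>T\<in>\<Union>m\<in>strips l (count M a). tableaux m ?M. map (filter (\<lambda>x. x \<noteq> a)) (fill_rows a l T) = T"
    using fill_rows_tableau(2) less by blast
  show "map (filter (\<lambda>x. x \<noteq> a)) ` tableaux l M \<subseteq> (\<Union>m\<in>strips l (count M a). tableaux m ?M)"
    using filter_tableau[OF l _ a] by blast
  show "fill_rows a l ` (\<Union>m\<in>strips l (count M a). tableaux m ?M) \<subseteq> tableaux l M"
    using fill_rows_tableau(1)[OF _ _ less] mset_split[of M a] by fastforce
qed

lemma card_tableaux_empty:
  assumes "sorted_wrt (\<ge>) l"
  shows "finite (tableaux l {#})"
    "rat_of_nat (card (tableaux l {#})) = sym_coeff (column.col (conj_partition l)) {#}"
proof -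
  have "tableaux l {#} = (if set l \<subseteq> {0} then {map (\<lambda>_. []) l} else {})"
  proof (cases "set l \<subseteq> {0}")
    case True
    then have l: "l ! i = 0" if "i < length l" for i
      using nth_mem[OF that] by auto
    have "T = map (\<lambda>_. []) l" if "T \<in> tableaux l {#}" for T
    proof (rule nth_equalityI)
      show "length T = length (map (\<lambda>_. []) l)" using tableauxD(1)[OF that] by simp
      fix i assume "i < length T"
      then have i: "i < length l" using tableauxD(1)[OF that] by simp
      then show "T ! i = map (\<lambda>_. []) l ! i" using tableauxD(2)[OF that i] l[OF i] by simp
    qed
    moreover have "map (\<lambda>_. []) l \<in> tableaux l {#}"
      by (rule tableauxI) (simp_all add: l)
    ultimately have "tableaux l {#} = {map (\<lambda>_. []) l}" by blast
    then show ?thesis using True by simp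
  next
    case False
    have "T \<notin> tableaux l {#}" for T
    proof
      assume "T \<in> tableaux l {#}"
      from tableauxD(7)[OF this] False show False by (simp add: subset_iff)
    qed
    then show ?thesis using False by auto
  qed
  moreover have "sym_coeff (column.col (conj_partition l)) {#} = (if set l \<subseteq> {0} then 1 else 0)"
  proof (cases "set l \<subseteq> {0}")
    case True
    then have "conj_partition l = []" by (cases l) (auto simp: conj_partition_def)
    then show ?thesis using True by (simp add: sym_coeff_simps)
  next
    case False
    then obtain x m where l: "l = x # m" by (cases l) auto
    have "x > 0"
    proof (rule gr0I)
      assume "x = 0"
      with False assms l show False by auto
    qed
    then have "[0..<x] = 0 # [1..<x]" by (simp add: upt_rec[of 0])
    then obtain b where "conj_partition l = length (filter (\<lambda>a. 0 < a) l) # b"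
      by (simp add: conj_partition_def l)
    moreover have "length (filter (\<lambda>a. 0 < a) l) > 0" using l \<open>x > 0\<close> by simp
    ultimately show ?thesis using False by (simp add: sym_coeff_column_op_empty)
  qed
  ultimately show "finite (tableaux l {#})"
    "rat_of_nat (card (tableaux l {#})) = sym_coeff (column.col (conj_partition l)) {#}"
    by auto
qed

text \<open>Induction on the content, removing its largest element.  This also shows that counting tableaux
  by content gives a symmetric function.\<close>

lemma card_tableaux:
  "sorted_wrt (\<ge>) l \<Longrightarrow> finite (tableaux l M) \<and>
    rat_of_nat (card (tableaux l M)) = sym_coeff (column.col (conj_partition l)) M"
proof (induction "size M" arbitrary: M l rule: less_induct)
  case less
  show ?case
  proof (cases "M = {#}")
    case True
    then show ?thesis using card_tableaux_empty[OF less.prems] by simp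
  next
    case False
    define a where "a = Max (set_mset M)"
    define k where "k = count M a"
    define M' where "M' = filter_mset (\<lambda>x. x \<noteq> a) M"
    have a: "\<forall>x\<in>#M. x \<le> a" "a \<in># M" using False by (auto simp: a_def)
    have M: "M = M' + replicate_mset k a" unfolding M'_def k_def by (rule mset_split)
    have "size M = size M' + k" using arg_cong[OF M, of size] by simp
    then have "size M' < size M" using a(2) by (simp add: k_def)
    then have IH: "finite (tableaux m M')"
      "rat_of_nat (card (tableaux m M')) = sym_coeff (column.col (conj_partition m)) M'"
      if "m \<in> strips l k" for m
      using less.hyps strips_sorted[OF that] by blast+
    have bij: "bij_betw (map (filter (\<lambda>x. x \<noteq> a))) (tableaux l M) (\<Union>m\<in>strips l k. tableaux m M')"
      unfolding M'_def k_def by (rule bij_betw_tableaux[OF less.prems a(1)])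
    have disj: "tableaux m M' \<inter> tableaux n M' = {}" if "m \<noteq> n" for m n
      using that by (auto simp: tableaux_def ssyt_def)
    have "finite (\<Union>m\<in>strips l k. tableaux m M')" using IH(1) finite_strips by blast
    then have fin: "finite (tableaux l M)" using bij_betw_finite[OF bij] by simp
    have "rat_of_nat (card (tableaux l M)) = rat_of_nat (card (\<Union>m\<in>strips l k. tableaux m M'))"
      by (simp add: bij_betw_same_card[OF bij])
    also have "card (\<Union>m\<in>strips l k. tableaux m M') = (\<Sum>m\<in>strips l k. card (tableaux m M'))"
      using IH(1) disj by (intro card_UN_disjoint finite_strips) auto
    also have "rat_of_nat \<dots> = (\<Sum>m\<in>strips l k. sym_coeff (column.col (conj_partition m)) M')"
      by (simp add: IH(2))
    also have "\<dots> = sym_coeff (hperp k (column.col (conj_partition l))) M'"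
      by (simp add: hperp_col_strips[OF less.prems] sym_coeff_sum)
    also have "\<dots> = sym_coeff (column.col (conj_partition l)) M"
      by (subst sym_coeff_hperp[of a]) (simp_all add: M'_def flip: M[unfolded M'_def])
    finally show ?thesis using fin by simp
  qed
qed

lemma schur_eq_col:
  assumes "l \<in> partitions"
  shows "schur l = column.col (conj_partition l)"
proof -
  have "sorted_wrt (\<ge>) l" using assms by (simp add: partitions_def)
  then have "Mps (\<lambda>M. of_nat (card {T \<in> ssyt l. mset (concat T) = M})) =
      mps_of_sym (column.col (conj_partition l))"
    by (intro mps_eqI) (simp add: Mps_inverse card_tableaux flip: tableaux_def)
  then show ?thesis by (simp add: schur_def mps_of_sym_inverse)
qed

lemma bij_betw_conj_partition: "bij_betw conj_partition partitions partitions"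
  by (rule bij_betw_byWitness[where f' = conj_partition])
    (auto simp: conj_partition_partition conj_partition_conj_partition)

lemma schur_combination_eq_0:
  assumes "finite T" "T \<subseteq> partitions" "(\<Sum>l\<in>T. scale_sym (c l) (schur l)) = 0" "l \<in> T"
  shows "c l = 0"
proof -
  have inj: "inj_on conj_partition T"
    using bij_betw_conj_partition assms(2) by (meson bij_betw_def inj_on_subset)
  have "(\<Sum>a\<in>conj_partition ` T. scale_sym (c (conj_partition a)) (column.col a)) =
      (\<Sum>l\<in>T. scale_sym (c l) (schur l))"
    using assms(2) by (simp add: sum.reindex[OF inj]) 
      (intro sum.cong refl, auto simp: schur_eq_col conj_partition_conj_partition)
  then have "c (conj_partition (conj_partition l)) = 0"
    using assms conj_partition_partition
    by (intro column.col_combination_eq_0[of "conj_partition ` T" "\<lambda>a. c (conj_partition a)"]) auto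
  then show ?thesis using assms by (simp add: conj_partition_conj_partition subset_iff)
qed

lemma span_schur: "sym.span (schur ` partitions) = UNIV"
proof -
  have "schur ` partitions = column.col ` conj_partition ` partitions"
    by (simp add: image_image schur_eq_col cong: image_cong)
  then show ?thesis
    using bij_betw_conj_partition by (simp add: bij_betw_def column.span_col)
qed


section \<open>Two alphabets\<close>

text \<open>The series \<open>F(X) G(X')\<close>, the image of \<open>F \<otimes> G\<close>.\<close>

definition tensor :: "sym \<Rightarrow> sym \<Rightarrow> (nat + nat) mps"
  where "tensor F G = embed_mps Inl (mps_of_sym F) * embed_mps Inr (mps_of_sym G)"

lemma mcoeff_embed:
  "mcoeff (embed_mps i F) M =
    (if set_mset M \<subseteq> range i then mcoeff F (image_mset (inv i) M) else 0)"
  by (simp add: embed_mps_def Mps_inverse)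

lemma sum_multiset_cases:
  obtains A B where "M = image_mset Inl A + image_mset Inr B"
proof -
  have "\<exists>A B. M = image_mset Inl A + image_mset Inr B"
  proof (induction M)
    case (add x M)
    then obtain A B where M: "M = image_mset Inl A + image_mset Inr B" by blast
    show ?case
    proof (cases x)
      case (Inl a)
      then have "add_mset x M = image_mset Inl (add_mset a A) + image_mset Inr B" by (simp add: M)
      then show ?thesis by blast
    next
      case (Inr b)
      then have "add_mset x M = image_mset Inl A + image_mset Inr (add_mset b B)" by (simp add: M)
      then show ?thesis by blast
    qed
  qed auto
  then show ?thesis using that by blast
qed

lemma sum_submultisets_two_alphabets:
  "(\<Sum>C\<in>{C. C \<subseteq># image_mset Inl A + image_mset Inr B}. f C) =
    (\<Sum>A'\<in>{A'. A' \<subseteq># A}. \<Sum>B'\<in>{B'. B' \<subseteq># B}.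
      f (image_mset Inl A' + image_mset Inr B') :: 'c :: comm_monoid_add)"
proof -
  define j where "j = (\<lambda>(A', B'). image_mset Inl A' + image_mset Inr B' :: ('a + 'b) multiset)"
  define L where "L = (\<lambda>C :: ('a + 'b) multiset. image_mset projl (filter_mset isl C))"
  define R where "R = (\<lambda>C :: ('a + 'b) multiset. image_mset projr (filter_mset (\<lambda>x. \<not> isl x) C))"
  have LR: "L (image_mset Inl A' + image_mset Inr B') = A'"
    "R (image_mset Inl A' + image_mset Inr B') = B'"
    for A' B'
    by (simp_all add: L_def R_def filter_mset_image_mset multiset.map_comp comp_def)
  have "j (L C, R C) = C" for C
    using sum_multiset_cases[of C] LR by (metis (no_types, lifting) j_def case_prod_conv)
  moreover have "L C \<subseteq># A" "R C \<subseteq># B" if "C \<subseteq># image_mset Inl A + image_mset Inr B" for C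
    using that LR[of A B] unfolding L_def R_def
    by (metis image_mset_subseteq_mono multiset_filter_mono)+
  ultimately have "(\<Sum>C\<in>{C. C \<subseteq># image_mset Inl A + image_mset Inr B}. f C) =
      (\<Sum>p\<in>{A'. A' \<subseteq># A} \<times> {B'. B' \<subseteq># B}. f (j p))"
    by (intro sum.reindex_bij_witness[of _ j "\<lambda>C. (L C, R C)"])
      (auto simp: j_def LR intro!: subset_mset.add_mono image_mset_subseteq_mono)
  then show ?thesis by (simp add: sum.cartesian_product j_def split_def)
qed

lemma two_alphabets_diff:
  assumes "A' \<subseteq># A" "B' \<subseteq># B"
  shows "image_mset Inl A + image_mset Inr B - (image_mset Inl A' + image_mset Inr B') =
    image_mset Inl (A - A') + image_mset Inr (B - B')"
proof -
  obtain A'' B'' where "A = A' + A''" "B = B' + B''"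
    using assms by (metis subset_mset.add_diff_inverse)
  then have "image_mset Inl A + image_mset Inr B = (image_mset Inl A' + image_mset Inr B') +
      (image_mset Inl A'' + image_mset Inr B'')" "A - A' = A''" "B - B' = B''"
    by (simp_all add: ac_simps)
  then show ?thesis by (metis add_diff_cancel_left')
qed

lemma mcoeff_tensor:
  "mcoeff (tensor F G) (image_mset Inl A + image_mset Inr B) = sym_coeff F A * sym_coeff G B"
proof -
  have l: "mcoeff (embed_mps Inl (mps_of_sym F)) (image_mset Inl A' + image_mset Inr B') =
      (if B' = {#} then sym_coeff F A' else 0)" for A' B' :: "nat multiset"
    by (auto simp: mcoeff_embed multiset.map_comp comp_def image_subset_iff)
  have r: "mcoeff (embed_mps Inr (mps_of_sym G)) (image_mset Inl A' + image_mset Inr B') =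
      (if A' = {#} then sym_coeff G B' else 0)" for A' B' :: "nat multiset"
    by (auto simp: mcoeff_embed multiset.map_comp comp_def image_subset_iff)
  have "mcoeff (tensor F G) (image_mset Inl A + image_mset Inr B) =
      (\<Sum>A'\<in>{A'. A' \<subseteq># A}. \<Sum>B'\<in>{B'. B' \<subseteq># B}. if B' = {#} then
        sym_coeff F A' * (if A - A' = {#} then sym_coeff G B else 0) else 0)"
    unfolding tensor_def mcoeff_times sum_submultisets_two_alphabets
    by (intro sum.cong refl) (simp add: two_alphabets_diff l r)
  also have "\<dots> = (\<Sum>A'\<in>{A'. A' \<subseteq># A}. sym_coeff F A' * (if A - A' = {#} then sym_coeff G B else 0))"
    by (simp add: sum.delta)
  also have "\<dots> = (\<Sum>A'\<in>{A'. A' \<subseteq># A}. if A' = A then sym_coeff F A * sym_coeff G B else 0)"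
    by (intro sum.cong refl) (auto simp: Diff_eq_empty_iff_mset intro: subset_mset.antisym)
  finally show ?thesis by (simp add: sum.delta)
qed

lemma two_alphabet_eqI:
  assumes "\<And>A B. mcoeff F (image_mset Inl A + image_mset Inr B) =
    mcoeff G (image_mset Inl A + image_mset Inr B)"
  shows "F = (G :: (nat + nat) mps)"
  using assms by (intro mps_eqI) (metis sum_multiset_cases)

lemma tensor_add: "tensor (F + F') G = tensor F G + tensor F' G"
    "tensor F (G + G') = tensor F G + tensor F G'"
  and tensor_scale: "tensor (scale_sym c F) G = scale_mps c (tensor F G)"
    "tensor F (scale_sym c G) = scale_mps c (tensor F G)"
  and tensor_zero: "tensor 0 G = 0" "tensor F 0 = 0"
  by (rule two_alphabet_eqI;
      simp add: mcoeff_tensor mcoeff_simps mcoeff_scale sym_coeff_simps algebra_simps)+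

lemma tensor_times: "tensor F G * tensor F' G' = tensor (F * F') (G * G')"
proof (rule two_alphabet_eqI)
  fix A B
  have "mcoeff (tensor F G * tensor F' G') (image_mset Inl A + image_mset Inr B) =
      (\<Sum>A'\<in>{A'. A' \<subseteq># A}. \<Sum>B'\<in>{B'. B' \<subseteq># B}.
        (sym_coeff F A' * sym_coeff F' (A - A')) * (sym_coeff G B' * sym_coeff G' (B - B')))"
    unfolding mcoeff_times sum_submultisets_two_alphabets
    by (intro sum.cong refl) (simp add: two_alphabets_diff mcoeff_tensor)
  then show "mcoeff (tensor F G * tensor F' G') (image_mset Inl A + image_mset Inr B) =
      mcoeff (tensor (F * F') (G * G')) (image_mset Inl A + image_mset Inr B)"
    by (simp add: mcoeff_tensor sym_coeff_times sum_product)
qed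

lemma scale_mps_simps:
  "scale_mps c (F + G) = scale_mps c F + scale_mps c G"
  "scale_mps c (scale_mps d F) = scale_mps (c * d) F"
  "scale_mps (c + d) F = scale_mps c F + scale_mps d F"
  "scale_mps 0 F = 0" "scale_mps 1 F = F" "scale_mps c 0 = 0"
  by (rule mps_eqI, simp add: mcoeff_scale mcoeff_simps algebra_simps)+

lemma scale_mps_times: "scale_mps c F * scale_mps d G = scale_mps (c * d) (F * G)"
  by (rule mps_eqI) (simp add: mcoeff_scale mcoeff_times sum_distrib_left mult_ac)

lemma scale_mps_sum: "scale_mps c (sum F A) = (\<Sum>x\<in>A. scale_mps c (F x))"
  by (induction A rule: infinite_finite_induct) (simp_all add: scale_mps_simps)

lemma mcoeff_on_two_alphabets:
  "mcoeff (on_two_alphabets F) M = sym_coeff F (image_mset to_nat M)"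
  by (simp add: on_two_alphabets_def on_alphabet_def Mps_inverse)

lemma on_two_alphabets_add: "on_two_alphabets (F + G) = on_two_alphabets F + on_two_alphabets G"
  and on_two_alphabets_scale: "on_two_alphabets (scale_sym c F) = scale_mps c (on_two_alphabets F)"
  by (rule mps_eqI, simp add: mcoeff_on_two_alphabets mcoeff_simps mcoeff_scale sym_coeff_simps)+

lemma on_two_alphabets_times: "on_two_alphabets (F * G) = on_two_alphabets F * on_two_alphabets G"
proof (rule mps_eqI)
  fix M :: "(nat + nat) multiset"
  have inv: "image_mset from_nat (image_mset to_nat A) = A" for A :: "(nat + nat) multiset"
    by (simp add: multiset.map_comp comp_def)
  have "image_mset to_nat (image_mset from_nat A :: (nat + nat) multiset) = A"
    if "A \<subseteq># image_mset to_nat M" for A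
  proof -
    have "image_mset (to_nat \<circ> (from_nat :: nat \<Rightarrow> nat + nat)) A = image_mset id A"
      using set_mset_mono[OF that] by (intro image_mset_cong) auto
    then show ?thesis by (simp add: multiset.map_comp)
  qed
  moreover have "image_mset from_nat A \<subseteq># M" if "A \<subseteq># image_mset to_nat M" for A
    using image_mset_subseteq_mono[OF that, of "from_nat :: nat \<Rightarrow> nat + nat"] by (simp only: inv)
  ultimately show "mcoeff (on_two_alphabets (F * G)) M = mcoeff (on_two_alphabets F * on_two_alphabets G) M"
    unfolding mcoeff_on_two_alphabets mcoeff_times sym_coeff_times
    by (intro sum.reindex_bij_witness[of _ "image_mset to_nat" "image_mset from_nat"])
      (auto simp: inv image_mset_Diff intro: image_mset_subseteq_mono)
qed

lemma on_two_alphabets_h: "on_two_alphabets (sym_h n) = (\<Sum>i\<le>n. tensor (sym_h i) (sym_h (n - i)))"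
proof (rule two_alphabet_eqI)
  fix A B :: "nat multiset"
  have "(\<Sum>i\<le>n. sym_coeff (sym_h i) A * sym_coeff (sym_h (n - i)) B) =
      (\<Sum>i\<le>n. if i = size A then (if size B = n - size A then 1 else 0) else 0)"
    by (intro sum.cong refl) (simp add: sym_coeff_h)
  also have "\<dots> = (if size A + size B = n then 1 else 0)"
    by (auto simp: sum.delta)
  finally show "mcoeff (on_two_alphabets (sym_h n)) (image_mset Inl A + image_mset Inr B) =
      mcoeff (\<Sum>i\<le>n. tensor (sym_h i) (sym_h (n - i))) (image_mset Inl A + image_mset Inr B)"
    by (simp add: mcoeff_on_two_alphabets mcoeff_sum mcoeff_tensor sym_coeff_h)
qed

lemma on_two_alphabets_umbral_h:
  assumes "delta_series f"
  shows "on_two_alphabets (umbral f (sym_h n)) =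
    (\<Sum>i\<le>n. tensor (umbral f (sym_h i)) (umbral f (sym_h (n - i))))"
  by (rule two_alphabet_eqI)
    (simp add: mcoeff_on_two_alphabets mcoeff_sum mcoeff_tensor umbral_spec(2)[OF assms]
      power_add fps_mult_nth atLeast0AtMost)


section \<open>Littlewood--Richardson coefficients\<close>

text \<open>The pairs of indices with nonzero coefficient.\<close>

definition lr_support :: "(nat list \<Rightarrow> nat list \<Rightarrow> rat) \<Rightarrow> (nat list \<times> nat list) set"
  where "lr_support c = {(\<mu>, \<nu>). c \<mu> \<nu> \<noteq> 0}"

lemma two_alphabet_sum_superset:
  assumes "finite S" "lr_support c \<subseteq> S"
  shows "two_alphabet_sum c B = (\<Sum>(\<mu>, \<nu>)\<in>S. scale_mps (c \<mu> \<nu>) (tensor (B \<mu>) (B \<nu>)))"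
  unfolding two_alphabet_sum_def tensor_def[symmetric]
  using assms by (intro sum.mono_neutral_left) (auto simp: lr_support_def scale_mps_simps)

text \<open>\<open>parallel U a b\<close> says that \<open>a\<close> is a finite combination of products \<open>s\<^sub>\<mu>(X) s\<^sub>\<nu>(X')\<close> and \<open>b\<close> is the
  same combination of the products \<open>U[s\<^sub>\<mu>](X) U[s\<^sub>\<nu>](X')\<close>, i.e. the image of \<open>a\<close> under \<open>U \<otimes> U\<close>.\<close>

definition parallel :: "(sym \<Rightarrow> sym) \<Rightarrow> (nat + nat) mps \<Rightarrow> (nat + nat) mps \<Rightarrow> bool"
  where "parallel U a b \<longleftrightarrow> (\<exists>c. finite (lr_support c) \<and> lr_support c \<subseteq> partitions \<times> partitions \<and>
    a = two_alphabet_sum c schur \<and> b = two_alphabet_sum c (\<lambda>\<mu>. U (schur \<mu>)))"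

lemma parallel_add:
  assumes "parallel U a b" "parallel U a' b'"
  shows "parallel U (a + a') (b + b')"
proof -
  obtain c c' where c: "finite (lr_support c)" "lr_support c \<subseteq> partitions \<times> partitions"
      "a = two_alphabet_sum c schur" "b = two_alphabet_sum c (\<lambda>\<mu>. U (schur \<mu>))"
    and c': "finite (lr_support c')" "lr_support c' \<subseteq> partitions \<times> partitions"
      "a' = two_alphabet_sum c' schur" "b' = two_alphabet_sum c' (\<lambda>\<mu>. U (schur \<mu>))"
    using assms unfolding parallel_def by blast
  define d where "d = (\<lambda>\<mu> \<nu>. c \<mu> \<nu> + c' \<mu> \<nu>)"
  define S where "S = lr_support c \<union> lr_support c'"
  have S: "finite S" "lr_support c \<subseteq> S" "lr_support c' \<subseteq> S" "lr_support d \<subseteq> S"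
    "S \<subseteq> partitions \<times> partitions"
    using c(1,2) c'(1,2) by (auto simp: S_def lr_support_def d_def)
  have sum: "two_alphabet_sum d B = two_alphabet_sum c B + two_alphabet_sum c' B" for B
    unfolding two_alphabet_sum_superset[OF S(1,2)] two_alphabet_sum_superset[OF S(1,3)]
      two_alphabet_sum_superset[OF S(1,4)] sum.distrib[symmetric]
    by (intro sum.cong refl) (auto simp: d_def scale_mps_simps)
  have "finite (lr_support d)" "lr_support d \<subseteq> partitions \<times> partitions"
    using S by (auto intro: finite_subset)
  then show ?thesis
    unfolding parallel_def c(3,4) c'(3,4) sum[symmetric] by blast
qed

lemma parallel_schur:
  assumes "\<mu> \<in> partitions" "\<nu> \<in> partitions"
  shows "parallel U (scale_mps k (tensor (schur \<mu>) (schur \<nu>)))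
    (scale_mps k (tensor (U (schur \<mu>)) (U (schur \<nu>))))"
proof -
  define c where "c = (\<lambda>\<alpha> \<beta>. if \<alpha> = \<mu> \<and> \<beta> = \<nu> then k else 0)"
  have c: "lr_support c \<subseteq> {(\<mu>, \<nu>)}" by (auto simp: lr_support_def c_def)
  have "two_alphabet_sum c B = scale_mps k (tensor (B \<mu>) (B \<nu>))" for B
    by (subst two_alphabet_sum_superset[OF _ c]) (simp_all add: c_def)
  moreover have "finite (lr_support c)" "lr_support c \<subseteq> partitions \<times> partitions"
    using c assms by (auto intro: finite_subset)
  ultimately show ?thesis unfolding parallel_def by metis
qed

lemma parallel_zero: "parallel U 0 0"
  using parallel_schur[of "[]" "[]" U 0] by (simp add: scale_mps_simps partitions_def)

lemma parallel_sum:
  "(\<And>x. x \<in> S \<Longrightarrow> parallel U (a x) (b x)) \<Longrightarrow> parallel U (sum a S) (sum b S)"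
  by (induction S rule: infinite_finite_induct) (simp_all add: parallel_zero parallel_add)

lemma parallel_scale:
  assumes "parallel U a b"
  shows "parallel U (scale_mps k a) (scale_mps k b)"
proof -
  obtain c where c: "finite (lr_support c)" "lr_support c \<subseteq> partitions \<times> partitions"
      "a = two_alphabet_sum c schur" "b = two_alphabet_sum c (\<lambda>\<mu>. U (schur \<mu>))"
    using assms unfolding parallel_def by blast
  show ?thesis
    unfolding c(3,4) two_alphabet_sum_superset[OF c(1) order_refl] scale_mps_sum
    by (rule parallel_sum) (use c(2) parallel_schur in \<open>auto simp: scale_mps_simps\<close>)
qed

lemma parallel_tensor:
  assumes U: "sym_algebra_hom U"
  shows "parallel U (tensor F G) (tensor (U F) (U G))"
proof -
  note U_simps = sym_algebra_hom_simps[OF U]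
  have 1: "parallel U (tensor (schur \<mu>) G) (tensor (U (schur \<mu>)) (U G))" if \<mu>: "\<mu> \<in> partitions" for \<mu> G
  proof -
    have "G \<in> sym.span (schur ` partitions)" by (simp add: span_schur)
    then show ?thesis
    proof (induction rule: sym.span_induct_alt)
      case base
      show ?case by (simp add: tensor_zero U_simps parallel_zero)
    next
      case (step c x y)
      then show ?case
        by (auto simp: tensor_add tensor_scale U_simps intro!: parallel_add parallel_schur \<mu>)
    qed
  qed
  have "F \<in> sym.span (schur ` partitions)" by (simp add: span_schur)
  then show ?thesis
  proof (induction rule: sym.span_induct_alt)
    case base
    show ?case by (simp add: tensor_zero U_simps parallel_zero)
  next
    case (step c x y)
    then show ?case
      by (auto simp: tensor_add tensor_scale U_simps intro!: parallel_add parallel_scale 1)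
  qed
qed

lemma parallel_times:
  assumes U: "sym_algebra_hom U" and "parallel U a b" "parallel U a' b'"
  shows "parallel U (a * a') (b * b')"
proof -
  obtain c c' where c: "finite (lr_support c)"
      "a = two_alphabet_sum c schur" "b = two_alphabet_sum c (\<lambda>\<mu>. U (schur \<mu>))"
    and c': "finite (lr_support c')"
      "a' = two_alphabet_sum c' schur" "b' = two_alphabet_sum c' (\<lambda>\<mu>. U (schur \<mu>))"
    using assms unfolding parallel_def by blast
  show ?thesis
    unfolding c(2,3) c'(2,3) two_alphabet_sum_superset[OF c(1) order_refl]
      two_alphabet_sum_superset[OF c'(1) order_refl] sum_product
    by (intro parallel_sum)
      (auto simp: scale_mps_times tensor_times simp flip: sym_algebra_hom_simps(3)[OF U]
        intro!: parallel_scale parallel_tensor[OF U])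
qed

text \<open>The operator \<open>U\<^sub>f\<close> commutes with \<open>F \<mapsto> F(X+X')\<close>; it suffices to check this on the \<open>h\<^sub>n\<close>, where
  it says that the series \<open>\<Prod>\<^sub>x 1 / (1 - f(z) x)\<close> for \<open>X + X'\<close> is the product of those for \<open>X\<close> and \<open>X'\<close>.\<close>

lemma parallel_on_two_alphabets:
  assumes f: "delta_series f"
  shows "parallel (umbral f) (on_two_alphabets F) (on_two_alphabets (umbral f F))"
proof -
  note U = umbral_spec(1)[OF f]
  show ?thesis
  proof (induction F rule: sym_h_induct)
    case (h n)
    show ?case
      unfolding on_two_alphabets_h on_two_alphabets_umbral_h[OF f]
      by (intro parallel_sum parallel_tensor[OF U])
  qed (simp_all add: sym_algebra_hom_simps[OF U] on_two_alphabets_add on_two_alphabets_times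
      on_two_alphabets_scale parallel_add parallel_times[OF U] parallel_scale)
qed

text \<open>The products \<open>s\<^sub>\<mu>(X) s\<^sub>\<nu>(X')\<close> are linearly independent: taking the coefficient of a monomial in
  \<open>X'\<close> reduces this to the independence of the Schur functions, first in \<open>X\<close> and then in \<open>X'\<close>.\<close>

lemma tensor_schur_independent:
  assumes c: "finite (lr_support c)" "lr_support c \<subseteq> partitions \<times> partitions"
    and c': "finite (lr_support c')" "lr_support c' \<subseteq> partitions \<times> partitions"
    and eq: "two_alphabet_sum c schur = two_alphabet_sum c' schur"
  shows "c = c'"
proof -
  define S where "S = lr_support c \<union> lr_support c'"
  define d where "d = (\<lambda>\<mu> \<nu>. c \<mu> \<nu> - c' \<mu> \<nu>)"
  define T T' where "T = fst ` S" and "T' = snd ` S"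
  have "finite S" "S \<subseteq> partitions \<times> partitions"
    using c c' by (simp_all add: S_def)
  then have fin: "finite (T \<times> T')" "finite T" "finite T'" and T: "T \<subseteq> partitions" "T' \<subseteq> partitions"
    by (auto simp: T_def T'_def)
  have "S \<subseteq> T \<times> T'" unfolding T_def T'_def by (rule subset_fst_snd)
  then have supp: "lr_support c \<subseteq> T \<times> T'" "lr_support c' \<subseteq> T \<times> T'"
    by (simp_all add: S_def)
  have 1: "(\<Sum>\<mu>\<in>T. (\<Sum>\<nu>\<in>T'. d \<mu> \<nu> * sym_coeff (schur \<nu>) B) * sym_coeff (schur \<mu>) A) = 0" for A B
  proof -
    have "mcoeff (two_alphabet_sum b schur) (image_mset Inl A + image_mset Inr B) =
        (\<Sum>\<mu>\<in>T. (\<Sum>\<nu>\<in>T'. b \<mu> \<nu> * sym_coeff (schur \<nu>) B) * sym_coeff (schur \<mu>) A)"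
      if "lr_support b \<subseteq> T \<times> T'" for b
      unfolding two_alphabet_sum_superset[OF fin(1) that] sum.cartesian_product[symmetric]
      by (simp add: mcoeff_sum mcoeff_scale mcoeff_tensor sum_distrib_left mult_ac)
    from this[OF supp(1)] this[OF supp(2)] eq show ?thesis
      by (simp add: d_def left_diff_distrib sum_subtractf)
  qed
  have 2: "(\<Sum>\<nu>\<in>T'. d \<mu> \<nu> * sym_coeff (schur \<nu>) B) = 0" if "\<mu> \<in> T" for \<mu> B
  proof (rule schur_combination_eq_0[OF fin(2) T(1) _ that])
    show "(\<Sum>\<mu>\<in>T. scale_sym (\<Sum>\<nu>\<in>T'. d \<mu> \<nu> * sym_coeff (schur \<nu>) B) (schur \<mu>)) = 0"
      by (rule sym_eqI) (simp add: sym_coeff_sum sym_coeff_simps 1)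
  qed
  have 3: "d \<mu> \<nu> = 0" if "\<mu> \<in> T" "\<nu> \<in> T'" for \<mu> \<nu>
  proof (rule schur_combination_eq_0[OF fin(3) T(2) _ that(2)])
    show "(\<Sum>\<nu>\<in>T'. scale_sym (d \<mu> \<nu>) (schur \<nu>)) = 0"
      by (rule sym_eqI) (simp add: sym_coeff_sum sym_coeff_simps 2[OF that(1)])
  qed
  show ?thesis
  proof (intro ext)
    fix \<mu> \<nu>
    show "c \<mu> \<nu> = c' \<mu> \<nu>"
    proof (cases "(\<mu>, \<nu>) \<in> T \<times> T'")
      case True
      then show ?thesis using 3[of \<mu> \<nu>] by (simp add: d_def)
    next
      case False
      then have "(\<mu>, \<nu>) \<notin> lr_support c" "(\<mu>, \<nu>) \<notin> lr_support c'" using supp by blast+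
      then show ?thesis by (simp add: lr_support_def)
    qed
  qed
qed

lemma lr_coeff_eq:
  assumes "finite (lr_support c)" "lr_support c \<subseteq> partitions \<times> partitions"
    and "on_two_alphabets (schur l) = two_alphabet_sum c schur"
  shows "lr_coeff l = c"
  unfolding lr_coeff_def lr_support_def[symmetric]
proof (rule the_equality)
  fix d assume "finite (lr_support d) \<and> lr_support d \<subseteq> partitions \<times> partitions \<and>
    on_two_alphabets (schur l) = two_alphabet_sum d schur"
  then show "d = c"
    using assms by (intro tensor_schur_independent) simp_all
qed (use assms in blast)

lemma basis_of_sym_umbral_schur:
  assumes f: "delta_series f" and g: "delta_series g"
    and fg: "fps_compose f g = fps_X" and gf: "fps_compose g f = fps_X"
  shows "basis_of_sym (\<lambda>l. umbral f (schur l))"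
proof (rule basis_of_symI)
  note Uf = sym_algebra_hom_simps[OF umbral_spec(1)[OF f]]
  note Ug = sym_algebra_hom_simps[OF umbral_spec(1)[OF g]]
  {
    fix T c a
    assume T: "finite T" "T \<subseteq> partitions" "a \<in> T"
      and "(\<Sum>a\<in>T. scale_sym (c a) (umbral f (schur a))) = 0"
    then have "umbral g (\<Sum>a\<in>T. scale_sym (c a) (umbral f (schur a))) = 0"
      by (simp add: Ug)
    then have "(\<Sum>a\<in>T. scale_sym (c a) (schur a)) = 0"
      by (simp add: sym_algebra_hom_sum[OF umbral_spec(1)[OF g]] Ug umbral_inverse[OF f g gf])
    with T show "c a = 0" using schur_combination_eq_0 by blast
  }
  have "F \<in> sym.span ((\<lambda>l. umbral f (schur l)) ` partitions)" (is "_ \<in> ?S") for F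
  proof -
    have "umbral g F \<in> sym.span (schur ` partitions)" by (simp add: span_schur)
    then have "umbral f (umbral g F) \<in> ?S"
    proof (induction rule: sym.span_induct_alt)
      case base
      show ?case by (simp add: Uf sym.span_zero)
    next
      case (step c x y)
      then show ?case
        by (auto simp: Uf intro!: sym.span_add sym.span_scale intro: sym.span_base)
    qed
    then show ?thesis by (simp add: umbral_inverse[OF g f fg])
  qed
  then show "sym.span ((\<lambda>l. umbral f (schur l)) ` partitions) = UNIV" by blast
qed

lemma lr_coeff_umbral:
  assumes "delta_series f"
  shows "lr_support (lr_coeff l) \<subseteq> partitions \<times> partitions"
    and "on_two_alphabets (umbral f (schur l)) =
      two_alphabet_sum (lr_coeff l) (\<lambda>\<mu>. umbral f (schur \<mu>))"
proof -
  obtain c where c: "finite (lr_support c)" "lr_support c \<subseteq> partitions \<times> partitions"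
    "on_two_alphabets (schur l) = two_alphabet_sum c schur"
    "on_two_alphabets (umbral f (schur l)) = two_alphabet_sum c (\<lambda>\<mu>. umbral f (schur \<mu>))"
    using parallel_on_two_alphabets[OF assms, of "schur l"] unfolding parallel_def by blast
  then have "lr_coeff l = c" by (intro lr_coeff_eq)
  with c show "lr_support (lr_coeff l) \<subseteq> partitions \<times> partitions"
    "on_two_alphabets (umbral f (schur l)) = two_alphabet_sum (lr_coeff l) (\<lambda>\<mu>. umbral f (schur \<mu>))"
    by simp_all
qed

theorem proposition1p8:
  fixes f g :: "rat fps"
  assumes "delta_series f" and "delta_series g"
    and "fps_compose f g = fps_X" and "fps_compose g f = fps_X"
  shows "basis_of_sym (umbral_schur f g) \<and> lr_type (umbral_schur f g)"
proof
  have P: "umbral_schur f g l = umbral f (schur l)" if "l \<in> partitions" for l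
    using that by (simp add: umbral_schur_eq[OF assms(1,2,4)] schur_eq_col)
  then have "umbral_schur f g ` partitions = (\<lambda>l. umbral f (schur l)) ` partitions"
    "inj_on (umbral_schur f g) partitions \<longleftrightarrow> inj_on (\<lambda>l. umbral f (schur l)) partitions"
    by (auto cong: inj_on_cong)
  then show "basis_of_sym (umbral_schur f g)"
    using basis_of_sym_umbral_schur[OF assms] by (simp add: basis_of_sym_def)
  have "two_alphabet_sum (lr_coeff l) (umbral_schur f g) =
      two_alphabet_sum (lr_coeff l) (\<lambda>\<mu>. umbral f (schur \<mu>))" for l
    unfolding two_alphabet_sum_def lr_support_def[symmetric]
    using lr_coeff_umbral(1)[OF assms(1), of l] by (intro sum.cong refl) (auto simp: P subset_iff)
  then show "lr_type (umbral_schur f g)"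
    using lr_coeff_umbral(2)[OF assms(1)] P by (simp add: lr_type_def)
qed

end
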